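(* Let $t \geq 2$ and $d,d^* \geq 1$ be integers, and let $G=G_{A,B}$ be a bipartite graph with parts $A,B$, $|A|=m$ and $|B|=n$, satisfying $\pi_G(\ell)=O(\ell^d)$ and $\pi_G^*(\ell)=O(\ell^{d^*})$ for all $\ell$. If $G$ is $K_{t,t}$-free, then $$ |E(G)|=O_{t,d,d^*}\left(\min \left\{ m n^{1-\frac{1}{d}}+n^{1+\frac{1}{d}} \log n,\; n m^{1-\frac{1}{d^*}}+m^{1+\frac{1}{d^*}} \log m \right\}\right).$$
   Context: For a bipartite graph $G=G_{A,B}$ with edge set $E(G)\subset A\times B$, $N(v)$ denotes the (open) neighborhood of a vertex $v$. The primal shatter function of $G$ is $\pi_G(\ell)=\max_{S\subset A,|S|=\ell}|\{S\cap N(b): b\in B\}|$, and the dual shatter function is $\pi^*_G(\ell)=\max_{S\subset B,|S|=\ell}|\{S\cap N(a): a\in A\}|$. The hypotheses $\pi_G(\ell)=O(\ell^d)$, $\pi^*_G(\ell)=O(\ell^{d^*})$ mean bounded by $C\ell^d$, $C\ell^{d^*}$ for a fixed constant $C$; the implied constant in the conclusion depends on $t,d,d^*$ (and $C$). $G$ is $K_{t,t}$-free if it contains no complete bipartite subgraph with $t$ vertices in $A$ and $t$ vertices in $B$. *)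

theory Defs
  imports Complex_Main
begin

text \<open>
  A bipartite graph consists of vertex sets \<open>A :: 'a set\<close>, \<open>B :: 'b set\<close> and an edge set
  \<open>E \<subseteq> A \<times> B\<close>. The two parts live in different (possibly equal) types, so they are
  understood to be disjoint. For \<open>b \<in> B\<close> the neighbourhood is \<open>E\<inverse> `` {b}\<close>,
  for \<open>a \<in> A\<close> it is \<open>E `` {a}\<close>.
\<close>

definition bipartite_graph :: "'a set \<Rightarrow> 'b set \<Rightarrow> ('a \<times> 'b) set \<Rightarrow> bool" where
  "bipartite_graph A B E \<longleftrightarrow> finite A \<and> finite B \<and> E \<subseteq> A \<times> B"

text \<open>
  For finite \<open>A\<close>, \<open>B\<close> the supremum below is a maximum over a finite set of natural numbers.
  For \<open>l > card A\<close> the set is empty and the value is \<open>0\<close> (whereas \<open>Max {}\<close> is unspecified).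
\<close>

definition primal_shatter :: "'a set \<Rightarrow> 'b set \<Rightarrow> ('a \<times> 'b) set \<Rightarrow> nat \<Rightarrow> nat" where
  "primal_shatter A B E l =
     (SUP S \<in> {S. S \<subseteq> A \<and> card S = l}. card ((\<lambda>b. S \<inter> E\<inverse> `` {b}) ` B))"

definition dual_shatter :: "'a set \<Rightarrow> 'b set \<Rightarrow> ('a \<times> 'b) set \<Rightarrow> nat \<Rightarrow> nat" where
  "dual_shatter A B E l =
     (SUP S \<in> {S. S \<subseteq> B \<and> card S = l}. card ((\<lambda>a. S \<inter> E `` {a}) ` A))"

definition biclique_free :: "nat \<Rightarrow> 'a set \<Rightarrow> 'b set \<Rightarrow> ('a \<times> 'b) set \<Rightarrow> bool" where
  "biclique_free t A B E \<longleftrightarrow>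
     \<not> (\<exists>S T. S \<subseteq> A \<and> T \<subseteq> B \<and> card S = t \<and> card T = t \<and> S \<times> T \<subseteq> E)"

end

theory Submission
  imports Defs "HOL-Library.Disjoint_Sets"
begin

text \<open>
  By symmetry it suffices to prove the first bound from the primal shatter function. A set
  \<open>S \<subseteq> A\<close> has at most \<open>C * card S ^ d\<close> traces, and by \<open>K\<^bsub>t,t\<^esub>\<close>-freeness fewer than \<open>t\<close>
  vertices of \<open>B\<close> share a trace of size at least \<open>t\<close>. So at most \<open>c * card S ^ d\<close> vertices of \<open>B\<close>
  have \<open>t\<close> neighbours in \<open>S\<close>. For a random \<open>S\<close> of size about \<open>n powr (1 / d)\<close> this yields a vertex
  of \<open>B\<close> of degree \<open>O(m * n powr (- 1 / d) + 1)\<close>; removing such vertices one by one and summing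
  gives the bound for \<open>d \<ge> 2\<close>, and \<open>O(m * ln n + n)\<close> for \<open>d = 1\<close>.

  For \<open>d = 1\<close> the logarithm is harmless if only the vertices of \<open>A\<close> of degree at least a large
  constant are counted, provided that there are at most \<open>n\<^sup>2\<close> of them. Otherwise take \<open>n\<^sup>2\<close> of them
  and view their neighbourhoods as hyperedges on \<open>B\<close>. After restricting to vertices of \<open>B\<close> whose
  degrees differ by a small power of \<open>n\<close> and discarding pairs of high codegree, a suitably biased
  random set \<open>S\<close> of hyperedges covers most of its vertices at least \<open>t\<close> times but a bounded number
  of times on average, which contradicts the linear bound \<open>c * card S\<close>.
\<close>

subsection \<open>Degrees from random samples\<close>

lemma card_trace_ge_le:
  fixes C :: real
  assumes G: "bipartite_graph A B E" and free: "biclique_free t A B E"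
    and sh: "\<And>l. 1 \<le> l \<Longrightarrow> real (primal_shatter A B E l) \<le> C * real l ^ d"
    and S: "S \<subseteq> A" "S \<noteq> {}"
  shows "real (card {b\<in>B. t \<le> card (S \<inter> E\<inverse> `` {b})}) \<le> real t * C * real (card S) ^ d"
proof -
  have fin: "finite A" "finite B" "finite S" and EAB: "E \<subseteq> A \<times> B"
    using G S finite_subset by (auto simp: bipartite_graph_def)
  let ?tr = "\<lambda>b. S \<inter> E\<inverse> `` {b}"
  let ?H = "{b\<in>B. t \<le> card (?tr b)}"
  \<comment> \<open>Otherwise \<open>t\<close> vertices with the common trace \<open>T\<close> and
    \<open>t\<close> elements of \<open>T\<close> span a forbidden biclique.\<close>
  have fib: "card {b\<in>?H. ?tr b = T} \<le> t" if T: "T \<in> ?tr ` B" for T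
  proof (rule ccontr)
    assume neg: "\<not> ?thesis"
    then obtain Q where Q: "Q \<subseteq> {b\<in>?H. ?tr b = T}" "card Q = t"
      by (meson nat_le_linear obtain_subset_with_card_n)
    have "{b\<in>?H. ?tr b = T} \<noteq> {}" using neg by (metis card.empty zero_le)
    then have "t \<le> card T" by auto
    then obtain P where P: "P \<subseteq> T" "card P = t"
      by (meson obtain_subset_with_card_n)
    have "P \<times> Q \<subseteq> E" using P Q by blast
    moreover have "P \<subseteq> A" "Q \<subseteq> B" using P Q T S by auto
    ultimately show False using free P Q unfolding biclique_free_def by blast
  qed
  have "card ?H = card (\<Union>T\<in>?tr ` B. {b\<in>?H. ?tr b = T})"
    by (rule arg_cong[where f = card]) auto
  also have "\<dots> \<le> (\<Sum>T\<in>?tr ` B. card {b\<in>?H. ?tr b = T})"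
    using fin by (intro card_UN_le) auto
  also have "\<dots> \<le> (\<Sum>T\<in>?tr ` B. t)" using fib by (rule sum_mono)
  finally have 1: "card ?H \<le> t * card (?tr ` B)" by (simp add: mult.commute)
  have "card (?tr ` B) \<le> primal_shatter A B E (card S)"
    unfolding primal_shatter_def
  proof (rule cSUP_upper)
    show "S \<in> {S'. S' \<subseteq> A \<and> card S' = card S}" using S by simp
    show "bdd_above ((\<lambda>S. card ((\<lambda>b. S \<inter> E\<inverse> `` {b}) ` B)) ` {S'. S' \<subseteq> A \<and> card S' = card S})"
      using fin by (intro bdd_aboveI[of _ "card B"]) (auto intro: card_image_le)
  qed
  with sh[of "card S"] S fin have "real (card (?tr ` B)) \<le> C * real (card S) ^ d"
    by (smt (verit) One_nat_def Suc_leI card_gt_0_iff of_nat_le_iff)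
  then have "real t * real (card (?tr ` B)) \<le> real t * (C * real (card S) ^ d)"
    by (intro mult_left_mono) auto
  with 1 show ?thesis
    by (smt (verit) mult.assoc of_nat_le_iff of_nat_mult)
qed

lemma disjoint_subsets_of_card:
  assumes "finite X" "t * k \<le> card X"
  shows "\<exists>P. (\<forall>i<t. P i \<subseteq> X \<and> card (P i) = k) \<and> disjoint_family_on P {..<t::nat}"
  using assms
proof (induction t arbitrary: X)
  case 0
  then show ?case by (auto simp: disjoint_family_on_def)
next
  case (Suc t)
  obtain Y where Y: "Y \<subseteq> X" "card Y = k"
    using Suc.prems obtain_subset_with_card_n[of k X] by auto
  have "t * k \<le> card (X - Y)"
    using Suc.prems Y by (simp add: card_Diff_subset finite_subset)
  then obtain P where P: "\<forall>i<t. P i \<subseteq> X - Y \<and> card (P i) = k" "disjoint_family_on P {..<t}"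
    using Suc.IH[of "X - Y"] Suc.prems by auto
  have "\<forall>i<Suc t. (P(t := Y)) i \<subseteq> X \<and> card ((P(t := Y)) i) = k"
    using P Y by (auto simp: less_Suc_eq)
  moreover have "disjoint_family_on (P(t := Y)) {..<Suc t}"
    unfolding disjoint_family_on_def
  proof (intro ballI impI)
    fix i j assume "i \<in> {..<Suc t}" "j \<in> {..<Suc t}" "i \<noteq> j"
    then consider "i < t" "j < t" | "i = t" "j < t" | "i < t" "j = t" by force
    then show "(P(t := Y)) i \<inter> (P(t := Y)) j = {}"
    proof cases
      case 1
      then show ?thesis using P(2) \<open>i \<noteq> j\<close> by (simp add: disjoint_family_on_def)
    qed (use P(1) in auto)
  qed
  ultimately show ?case by blast
qed

text \<open>
  Split each \<open>N b\<close> into \<open>t\<close> disjoint parts: a random sequence of length \<open>s\<close> hits all parts of at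
  least half of the \<open>N b\<close>, on average.
\<close>

lemma exists_sample_hitting_half:
  fixes N :: "'b \<Rightarrow> 'a set"
  assumes fin: "finite A" "finite B" and NA: "\<And>b. b \<in> B \<Longrightarrow> N b \<subseteq> A"
    and A: "A \<noteq> {}" and s: "1 \<le> s" and t: "1 \<le> t"
    and k: "real (card A) * ln (2 * real t) \<le> real k * real s"
    and big: "\<And>b. b \<in> B \<Longrightarrow> t * k \<le> card (N b)"
  shows "\<exists>S\<subseteq>A. S \<noteq> {} \<and> card S \<le> s \<and> real (card B) \<le> 2 * real (card {b\<in>B. t \<le> card (S \<inter> N b)})"
proof -
  define m where "m = card A"
  have m: "m > 0" using A fin by (auto simp: m_def card_gt_0_iff)
  have "\<forall>b\<in>B. \<exists>P. (\<forall>i<t. P i \<subseteq> N b \<and> card (P i) = k) \<and> disjoint_family_on P {..<t}"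
    using big NA fin by (blast intro: disjoint_subsets_of_card finite_subset)
  then obtain P where P: "\<And>b i. b \<in> B \<Longrightarrow> i < t \<Longrightarrow> P b i \<subseteq> N b \<and> card (P b i) = k"
    "\<And>b. b \<in> B \<Longrightarrow> disjoint_family_on (P b) {..<t}"
    by (atomize_elim, subst (asm) bchoice_iff) blast
  \<comment> \<open>Sampling is with replacement, so \<open>set xs\<close> may have fewer than
    \<open>s\<close> elements. In exchange, the sequences avoiding a given part are counted by a
    plain power.\<close>
  define X where "X = {xs. set xs \<subseteq> A \<and> length xs = s}"
  have finX: "finite X" unfolding X_def using fin finite_lists_length_eq by blast
  have cX: "card X = m ^ s" unfolding X_def m_def using fin card_lists_length_eq by blast
  define bad where "bad = (\<lambda>b xs. \<exists>i<t. set xs \<inter> P b i = {})"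
  have good: "t \<le> card (set xs \<inter> N b)" if "b \<in> B" "\<not> bad b xs" for b xs
  proof -
    have "\<forall>i\<in>{..<t}. \<exists>y. y \<in> set xs \<inter> P b i" using that unfolding bad_def by auto
    then obtain y where y: "\<And>i. i < t \<Longrightarrow> y i \<in> set xs \<inter> P b i" by (metis lessThan_iff)
    have "inj_on y {..<t}"
    proof (rule inj_onI)
      fix i j assume "i \<in> {..<t}" "j \<in> {..<t}" "y i = y j"
      with y[of i] y[of j] P(2)[OF that(1)] show "i = j"
        unfolding disjoint_family_on_def by (metis IntD2 IntI empty_iff lessThan_iff)
    qed
    then have "card (y ` {..<t}) = t" by (simp add: card_image)
    moreover have "y ` {..<t} \<subseteq> set xs \<inter> N b" using y P(1)[OF that(1)] by fastforce
    ultimately show ?thesis by (metis List.finite_set card_mono finite_Int)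
  qed
  \<comment> \<open>A part of size \<open>k\<close> is avoided with probability
    \<open>(1 - k / m) ^ s\<close>, which is at most \<open>exp (- k * s / m)\<close>. The
    assumption on \<open>k\<close> bounds this by \<open>1 / (2 * t)\<close>, so that the union
    bound over the \<open>t\<close> parts leaves failure probability at most one half.\<close>
  have miss: "2 * real t * real (card {xs\<in>X. set xs \<inter> P b i = {}}) \<le> real (m ^ s)"
    if b: "b \<in> B" and i: "i < t" for b i
  proof -
    have sub: "P b i \<subseteq> A" "card (P b i) = k" using P(1)[OF b i] NA[OF b] by auto
    have km: "k \<le> m" using sub fin by (metis card_mono m_def)
    have "{xs\<in>X. set xs \<inter> P b i = {}} = {xs. set xs \<subseteq> A - P b i \<and> length xs = s}"
      unfolding X_def by auto
    then have "card {xs\<in>X. set xs \<inter> P b i = {}} = card (A - P b i) ^ s"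
      using fin by (simp add: card_lists_length_eq)
    also have "card (A - P b i) = m - k"
      using sub fin by (simp add: card_Diff_subset finite_subset m_def)
    finally have c: "card {xs\<in>X. set xs \<inter> P b i = {}} = (m - k) ^ s" .
    have "1 - real k / real m \<le> exp (- (real k / real m))"
      using exp_ge_add_one_self[of "- (real k / real m)"] by simp
    then have "(1 - real k / real m) ^ s \<le> exp (- (real k / real m)) ^ s"
      using km m by (intro power_mono) (auto simp: field_simps)
    also have "\<dots> = exp (- (real k * real s / real m))"
      by (simp add: exp_of_nat_mult[symmetric] mult.commute)
    also have "\<dots> \<le> exp (- ln (2 * real t))"
      using k m by (simp add: m_def field_simps)
    also have "\<dots> = 1 / (2 * real t)" using t by (simp add: exp_minus inverse_eq_divide)
    finally have "2 * real t * (1 - real k / real m) ^ s \<le> 1" using t by (simp add: field_simps)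
    then have "2 * real t * (1 - real k / real m) ^ s * real m ^ s \<le> 1 * real m ^ s"
      by (intro mult_right_mono) auto
    moreover have "(1 - real k / real m) ^ s * real m ^ s = real ((m - k) ^ s)"
      using km m by (simp add: power_mult_distrib[symmetric] left_diff_distrib of_nat_diff)
    ultimately show ?thesis unfolding c by (simp add: mult.assoc)
  qed
  have badcount: "2 * real (card {xs\<in>X. bad b xs}) \<le> real (m ^ s)" if b: "b \<in> B" for b
  proof -
    have "{xs\<in>X. bad b xs} = (\<Union>i\<in>{..<t}. {xs\<in>X. set xs \<inter> P b i = {}})"
      unfolding bad_def by auto
    then have "card {xs\<in>X. bad b xs} \<le> (\<Sum>i<t. card {xs\<in>X. set xs \<inter> P b i = {}})"
      by (simp add: card_UN_le)
    then have "2 * real t * real (card {xs\<in>X. bad b xs})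
        \<le> 2 * real t * (\<Sum>i<t. real (card {xs\<in>X. set xs \<inter> P b i = {}}))"
      by (intro mult_left_mono) (auto simp flip: of_nat_sum)
    also have "\<dots> = (\<Sum>i<t. 2 * real t * real (card {xs\<in>X. set xs \<inter> P b i = {}}))"
      by (simp add: sum_distrib_left)
    also have "\<dots> \<le> (\<Sum>i<t. real (m ^ s))" using miss[OF b] by (intro sum_mono) auto
    also have "\<dots> = real t * real (m ^ s)" by simp
    finally show ?thesis using t by (simp add: mult.assoc mult.left_commute)
  qed
  have dc: "(\<Sum>xs\<in>X. card {b\<in>B. bad b xs}) = (\<Sum>b\<in>B. card {xs\<in>X. bad b xs})"
    using sum_multicount_gen[OF finX fin(2), of "\<lambda>xs b. bad b xs"] by simp
  have "\<exists>xs\<in>X. 2 * real (card {b\<in>B. bad b xs}) \<le> real (card B)"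
  proof (rule ccontr)
    assume "\<not> ?thesis"
    then have "\<And>xs. xs \<in> X \<Longrightarrow> real (card B) < 2 * real (card {b\<in>B. bad b xs})" by force
    moreover have "X \<noteq> {}" using cX m by auto
    ultimately have "(\<Sum>xs\<in>X. real (card B)) < (\<Sum>xs\<in>X. 2 * real (card {b\<in>B. bad b xs}))"
      using finX by (intro sum_strict_mono) auto
    also have "\<dots> = 2 * real (\<Sum>xs\<in>X. card {b\<in>B. bad b xs})" by (simp add: sum_distrib_left)
    also have "\<dots> = (\<Sum>b\<in>B. 2 * real (card {xs\<in>X. bad b xs}))"
      unfolding dc by (simp add: sum_distrib_left)
    also have "\<dots> \<le> (\<Sum>b\<in>B. real (m ^ s))" using badcount by (intro sum_mono)
    finally show False using cX by (simp add: mult.commute)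
  qed
  then obtain xs where xs: "xs \<in> X" "2 * real (card {b\<in>B. bad b xs}) \<le> real (card B)" by blast
  have "card B = card {b\<in>B. bad b xs} + card {b\<in>B. \<not> bad b xs}"
    using fin by (subst card_Un_disjoint[symmetric]) (auto intro: arg_cong[where f=card])
  moreover have "card {b\<in>B. \<not> bad b xs} \<le> card {b\<in>B. t \<le> card (set xs \<inter> N b)}"
    using fin good by (intro card_mono) auto
  ultimately have "real (card B) \<le> 2 * real (card {b\<in>B. t \<le> card (set xs \<inter> N b)})"
    using xs(2) by linarith
  moreover have "set xs \<subseteq> A" "set xs \<noteq> {}" "card (set xs) \<le> s"
    using xs(1) s card_length[of xs] by (auto simp: X_def)
  ultimately show ?thesis by blast
qed

text \<open>If all degrees were at least \<open>t * k\<close>, a sample of size at most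
  \<open>s\<close> would give at least half of \<open>B\<close> no fewer than \<open>t\<close>
  neighbours. The covering hypothesis allows only \<open>c * s ^ d\<close> such vertices. Making
  this less than half of \<open>card B\<close> dictates \<open>s\<close>, and then \<open>k\<close>
  is about \<open>card A * ln (2 * t) / s\<close>.\<close>

lemma exists_vertex_of_small_degree:
  fixes N :: "'b \<Rightarrow> 'a set" and c :: real
  assumes fin: "finite A" "finite B" and NA: "\<And>b. b \<in> B \<Longrightarrow> N b \<subseteq> A"
    and B: "B \<noteq> {}" and c: "c > 0" and d: "d \<ge> 1" and t: "t \<ge> 1"
    and cov: "\<And>S. S \<subseteq> A \<Longrightarrow> S \<noteq> {} \<Longrightarrow>
      real (card {b\<in>B. t \<le> card (S \<inter> N b)}) \<le> c * real (card S) ^ d"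
  shows "\<exists>b\<in>B. real (card (N b)) \<le>
    (2 * real t * ln (2 * real t) + 1) * (4 * c) powr (1 / real d) * (real (card A) * real (card B) powr (- 1 / real d)) + real t"
proof (cases "A = {}")
  case True
  then show ?thesis using NA B t c by fastforce
next
  case A: False
  define n where "n = real (card B)"
  define m where "m = real (card A)"
  have n: "n \<ge> 1" using B fin by (simp add: n_def card_gt_0_iff Suc_leI)
  have m: "m \<ge> 1" using A fin by (simp add: m_def card_gt_0_iff Suc_leI)
  \<comment> \<open>This is the real solution of \<open>c * x ^ d = n / 4\<close>. The sample size
    is its floor, which costs at most a factor 2 once \<open>x\<close> is at least 1.\<close>
  define x where "x = (n / (4 * c)) powr (1 / real d)"
  have x: "x > 0" using n c by (simp add: x_def)
  have xinv: "1 / x = (4 * c) powr (1 / real d) * n powr (- 1 / real d)"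
    using n c by (simp add: x_def powr_divide powr_minus_divide)
  have lt: "ln (2 * real t) \<ge> 0" using t by simp
  have "\<exists>b\<in>B. real (card (N b)) \<le> (2 * real t * ln (2 * real t) + 1) * (m / x) + real t"
  \<comment> \<open>For \<open>x < 1\<close> no nonempty sample is small enough, but then
    \<open>m \<le> m / x\<close> and the trivial degree bound \<open>m\<close> suffices.\<close>
  proof (cases "x < 1")
    case True
    obtain b where b: "b \<in> B" using B by blast
    have "real (card (N b)) \<le> m" using NA[OF b] fin by (simp add: m_def card_mono)
    also have "m \<le> m / x" using True x m by (simp add: field_simps)
    also have "\<dots> \<le> (2 * real t * ln (2 * real t) + 1) * (m / x)"
    proof -
      have "1 * (m / x) \<le> (2 * real t * ln (2 * real t) + 1) * (m / x)"
        using lt m x by (intro mult_right_mono) auto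
      then show ?thesis by simp
    qed
    finally show ?thesis using b t by (intro bexI[of _ b]) auto
  next
    case False
    define s where "s = nat \<lfloor>x\<rfloor>"
    have s: "s \<ge> 1" "real s \<le> x" using False unfolding s_def by linarith+
    have "x < real s + 1" using False unfolding s_def by linarith
    then have s3: "x \<le> 2 * real s" using s by simp
    have "real s ^ d \<le> x ^ d" using s by (intro power_mono) auto
    also have "x ^ d = n / (4 * c)" using n c d
      by (simp add: x_def powr_power)
    finally have "c * real s ^ d \<le> n / 4" using c by (simp add: field_simps)
    then have small: "2 * (c * real s ^ d) < n" using n by linarith
    define k where "k = nat \<lceil>m * ln (2 * real t) / real s\<rceil>"
    have k1: "m * ln (2 * real t) / real s \<le> real k" unfolding k_def by linarith
    have "0 \<le> m * ln (2 * real t) / real s" using m lt by simp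
    then have k2: "real k \<le> m * ln (2 * real t) / real s + 1" unfolding k_def by linarith
    have "\<exists>b\<in>B. card (N b) < t * k"
    proof (rule ccontr)
      assume "\<not> ?thesis"
      then have big: "\<And>b. b \<in> B \<Longrightarrow> t * k \<le> card (N b)" by force
      have "real (card A) * ln (2 * real t) \<le> real k * real s"
        using k1 s by (simp add: m_def field_simps)
      then obtain S where S: "S \<subseteq> A" "S \<noteq> {}" "card S \<le> s"
        "n \<le> 2 * real (card {b\<in>B. t \<le> card (S \<inter> N b)})"
        using exists_sample_hitting_half[where N = N, OF fin NA A s(1) t _ big] unfolding n_def by metis
      have "real (card S) ^ d \<le> real s ^ d" using S(3) by (intro power_mono) auto
      then have "c * real (card S) ^ d \<le> c * real s ^ d" using c by simp
      with cov[OF S(1,2)] S(4) small show False by linarith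
    qed
    then obtain b where b: "b \<in> B" "card (N b) < t * k" by blast
    have "m * ln (2 * real t) / real s \<le> m * ln (2 * real t) / (x / 2)"
      using s s3 x m lt by (intro divide_left_mono mult_nonneg_nonneg) auto
    with k2 have "real k \<le> 2 * ln (2 * real t) * (m / x) + 1" by (simp add: field_simps)
    then have "real t * real k \<le> real t * (2 * ln (2 * real t) * (m / x) + 1)"
      by (intro mult_left_mono) auto
    moreover have "real (card (N b)) \<le> real t * real k" using b(2)
      by (metis less_imp_le of_nat_le_iff of_nat_mult)
    moreover have "m / x \<ge> 0" using m x by simp
    ultimately have "real (card (N b)) \<le> (2 * real t * ln (2 * real t) + 1) * (m / x) + real t"
      by (simp add: algebra_simps)
    then show ?thesis using b by blast
  qed
  moreover have "m / x = m * (1 / x)" by simp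
  then have "m / x = (4 * c) powr (1 / real d) * (m * n powr (- 1 / real d))"
    unfolding xinv by (simp only: mult_ac)
  ultimately show ?thesis unfolding m_def n_def by (simp only: mult.assoc)
qed

text \<open>A vertex of small degree is removed repeatedly. The covering hypothesis passes to
  subsets of \<open>B\<close>, and the vertex removed when \<open>i\<close> vertices are left
  contributes the term with \<open>i powr (- 1 / d)\<close>.\<close>

lemma sum_degrees_le:
  fixes N :: "'b \<Rightarrow> 'a set" and c :: real
  assumes fin: "finite A" "finite B" and NA: "\<And>b. b \<in> B \<Longrightarrow> N b \<subseteq> A"
    and c: "c > 0" and d: "d \<ge> 1" and t: "t \<ge> 1"
    and cov: "\<And>S. S \<subseteq> A \<Longrightarrow> S \<noteq> {} \<Longrightarrow>
      real (card {b\<in>B. t \<le> card (S \<inter> N b)}) \<le> c * real (card S) ^ d"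
  shows "(\<Sum>b\<in>B. real (card (N b))) \<le>
    (2 * real t * ln (2 * real t) + 1) * (4 * c) powr (1 / real d) *
      (real (card A) * (\<Sum>i=1..card B. real i powr (- 1 / real d))) + real t * real (card B)"
    (is "_ \<le> ?M * (real (card A) * _) + _")
  using fin(2) NA cov
proof (induction "card B" arbitrary: B)
  case 0
  then show ?case by simp
next
  case (Suc n)
  have "B \<noteq> {}" using Suc.hyps(2) by auto
  from exists_vertex_of_small_degree[where N = N, OF fin(1) Suc.prems(1,2) this c d t Suc.prems(3)]
  obtain b where b: "b \<in> B"
    "real (card (N b)) \<le> ?M * (real (card A) * real (card B) powr (- 1 / real d)) + real t" by blast
  have n: "card (B - {b}) = n" using b Suc by simp
  have "(\<Sum>b\<in>B - {b}. real (card (N b))) \<le>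
    ?M * (real (card A) * (\<Sum>i=1..card (B - {b}). real i powr (- 1 / real d))) + real t * real (card (B - {b}))"
  proof (rule Suc.hyps(1))
    fix S assume S: "S \<subseteq> A" "S \<noteq> {}"
    have "card {b'\<in>B - {b}. t \<le> card (S \<inter> N b')} \<le> card {b\<in>B. t \<le> card (S \<inter> N b)}"
      using Suc.prems(1) by (intro card_mono) auto
    with Suc.prems(3)[OF S]
    show "real (card {b'\<in>B - {b}. t \<le> card (S \<inter> N b')}) \<le> c * real (card S) ^ d" by linarith
  qed (use n Suc.prems in auto)
  then have "(\<Sum>b\<in>B - {b}. real (card (N b))) \<le>
    ?M * (real (card A) * (\<Sum>i=1..n. real i powr (- 1 / real d))) + real t * real n"
    unfolding n .
  moreover have "(\<Sum>b\<in>B. real (card (N b))) = real (card (N b)) + (\<Sum>b\<in>B - {b}. real (card (N b)))"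
    using sum.remove[OF Suc.prems(1) b(1)] .
  moreover have "(\<Sum>i=1..Suc n. real i powr (- 1 / real d)) =
      (\<Sum>i=1..n. real i powr (- 1 / real d)) + real (Suc n) powr (- 1 / real d)"
    by simp
  ultimately show ?case using b(2)
    by (simp only: Suc.hyps(2)[symmetric] of_nat_Suc distrib_left)
qed

section \<open>Estimates for the power sums produced by removing vertices\<close>

lemma sum_powr_le:
  assumes "d \<ge> 2"
  shows "(\<Sum>i=1..n. real i powr (- 1 / real d)) \<le> 2 * real n powr (1 - 1 / real d)"
proof (induction n)
  case 0
  then show ?case by simp
next
  case (Suc n)
  define \<beta> where "\<beta> = 1 - 1 / real d"
  have \<beta>: "1 / 2 \<le> \<beta>" "\<beta> < 1" using assms by (auto simp: \<beta>_def field_simps)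
  define y where "y = real (Suc n)"
  have y: "y \<ge> 1" by (simp add: y_def)
  have yn: "y = real n + 1" by (simp add: y_def)
  \<comment> \<open>The square on the right is \<open>y - 1 + 1 / (4 * y)\<close>. This settles the
    induction step for exponent one half. The general step follows on multiplying by
    \<open>y powr (\<beta> - 1 / 2)\<close>, which is monotone in \<open>y\<close> because
    \<open>d \<ge> 2\<close> gives \<open>\<beta> \<ge> 1 / 2\<close>.\<close>
  have "real n \<le> (sqrt y - 1 / (2 * sqrt y))\<^sup>2"
    using y by (simp add: power2_diff power_divide yn)
  then have "sqrt (real n) \<le> sqrt ((sqrt y - 1 / (2 * sqrt y))\<^sup>2)" by (rule real_sqrt_le_mono)
  also have "\<dots> = sqrt y - 1 / (2 * sqrt y)"
  proof -
    have "1 \<le> sqrt y" using y by simp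
    moreover from this have "1 \<le> 2 * sqrt y" by linarith
    then have "1 / (2 * sqrt y) \<le> 1" by (metis divide_le_eq_1 zero_less_one order_less_le_trans)
    ultimately have "1 / (2 * sqrt y) \<le> sqrt y" by linarith
    then show ?thesis by simp
  qed
  finally have sq: "2 * sqrt (real n) + 1 / sqrt y \<le> 2 * sqrt y" by simp
  have split: "z powr \<beta> = z powr (\<beta> - 1 / 2) * sqrt z" if "z \<ge> 0" for z
    using that by (simp add: powr_half_sqrt[symmetric] powr_add[symmetric])
  have "real n powr (\<beta> - 1 / 2) \<le> y powr (\<beta> - 1 / 2)"
    using \<beta> by (intro powr_mono2) (auto simp: y_def)
  then have "2 * real n powr \<beta> \<le> y powr (\<beta> - 1 / 2) * (2 * sqrt (real n))"
    by (simp add: split mult_right_mono)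
  moreover have "y powr (\<beta> - 1) = y powr (\<beta> - 1 / 2) * (1 / sqrt y)"
    using y by (simp add: powr_half_sqrt[symmetric] powr_diff[symmetric])
  moreover have "y powr (\<beta> - 1 / 2) * (2 * sqrt (real n) + 1 / sqrt y) \<le> y powr (\<beta> - 1 / 2) * (2 * sqrt y)"
    using sq by (intro mult_left_mono) auto
  ultimately have "2 * real n powr \<beta> + y powr (\<beta> - 1) \<le> 2 * y powr \<beta>"
    using split[of y] y by (simp add: distrib_left)
  with Suc show ?case by (simp add: \<beta>_def y_def)
qed

lemma sum_powr_minus_one_le:
  assumes "n \<ge> 1"
  shows "(\<Sum>i=1..n. real i powr (- 1)) \<le> 1 + ln (real n)"
  using assms
proof (induction n rule: dec_induct)
  case base
  then show ?case by simp
next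
  case (step n)
  have "ln (real n / real (Suc n)) \<le> real n / real (Suc n) - 1"
    using step by (intro ln_le_minus_one) auto
  then have "1 / real (Suc n) \<le> ln (real (Suc n)) - ln (real n)"
    using step by (simp add: ln_div field_simps)
  moreover have "real (Suc n) powr (- 1) = 1 / real (Suc n)" by (simp add: powr_minus_divide)
  ultimately show ?case using step by simp
qed

subsection \<open>Hypergraphs of large uniformity\<close>

text \<open>The weight \<open>w Y\<close> is the probability that independent choices with
  probabilities \<open>p x\<close> produce exactly \<open>Y\<close>. All later expectations are
  finite sums against \<open>w\<close>, and containment events are the only ones they
  involve.\<close>

lemma independent_random_subset:
  fixes p :: "'x \<Rightarrow> real"
  assumes "finite X" and p: "\<And>x. x \<in> X \<Longrightarrow> 0 \<le> p x \<and> p x \<le> 1"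
  obtains w where "\<And>Y. Y \<subseteq> X \<Longrightarrow> 0 \<le> w Y"
    and "\<And>Z. Z \<subseteq> X \<Longrightarrow> (\<Sum>Y\<in>Pow X. w Y * of_bool (Z \<subseteq> Y)) = prod p Z"
proof
  let ?w = "\<lambda>Y. prod p Y * (\<Prod>x\<in>X - Y. 1 - p x)"
  show "0 \<le> ?w Y" if "Y \<subseteq> X" for Y
    using that p by (intro mult_nonneg_nonneg prod_nonneg) auto
  show "(\<Sum>Y\<in>Pow X. ?w Y * of_bool (Z \<subseteq> Y)) = prod p Z" if Z: "Z \<subseteq> X" for Z
  proof -
    \<comment> \<open>Setting the factor of an omitted element of \<open>Z\<close> to 0 removes
      exactly the terms in which \<open>Z\<close> is not contained in \<open>Y\<close>. What remains
      is a full expansion of a product of sums.\<close>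
    let ?g = "\<lambda>x. if x \<in> Z then 0 else 1 - p x"
    have wg: "prod p Y * prod ?g (X - Y) = ?w Y * of_bool (Z \<subseteq> Y)" if "Y \<subseteq> X" for Y
    proof (cases "Z \<subseteq> Y")
      case True
      then have "prod ?g (X - Y) = (\<Prod>x\<in>X - Y. 1 - p x)" by (intro prod.cong) auto
      then show ?thesis using True by simp
    next
      case False
      then have "prod ?g (X - Y) = 0" using Z assms(1) by (auto simp: prod_zero_iff)
      then show ?thesis using False by simp
    qed
    have "(\<Sum>Y\<in>Pow X. ?w Y * of_bool (Z \<subseteq> Y)) = (\<Sum>Y\<in>Pow X. prod p Y * prod ?g (X - Y))"
      by (intro sum.cong refl wg[symmetric]) blast
    also have "\<dots> = (\<Prod>x\<in>X. p x + ?g x)" using assms(1) by (rule prod_add[symmetric])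
    also have "\<dots> = (\<Prod>x\<in>X. if x \<in> Z then p x else 1)" by (intro prod.cong) auto
    also have "\<dots> = prod p Z" using assms(1) Z by (simp add: prod.If_cases Int_absorb1 Int_absorb2)
    finally show ?thesis .
  qed
qed

text \<open>
  Keep each vertex \<open>v\<close> with probability \<open>p v\<close> and, among the hyperedges all of whose vertices are
  kept, each one independently with probability \<open>\<rho> / prod p (F a)\<close>, so that every hyperedge
  survives with probability \<open>\<rho>\<close>. The number \<open>x\<close> of surviving hyperedges at \<open>v\<close> satisfies
  \<open>of_bool (t \<le> x) \<ge> \<kappa> * (x - t) - \<kappa>\<^sup>2 / 4 * x\<^sup>2\<close> since \<open>\<kappa> * x \<le> 1 + \<kappa>\<^sup>2 / 4 * x\<^sup>2\<close>.
\<close>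

lemma second_moment_covering_bound:
  fixes F :: "'a \<Rightarrow> 'b set" and p :: "'b \<Rightarrow> real" and \<rho> \<kappa> c :: real
  assumes fin: "finite A" "finite B" and FB: "\<And>a. a \<in> A \<Longrightarrow> F a \<subseteq> B"
    and p: "\<And>v. v \<in> B \<Longrightarrow> 0 < p v \<and> p v \<le> 1"
    and \<rho>: "0 \<le> \<rho>" "\<And>a. a \<in> A \<Longrightarrow> \<rho> \<le> prod p (F a)" and \<kappa>: "0 \<le> \<kappa>"
    and cov: "\<And>S. S \<subseteq> A \<Longrightarrow> real (card {v\<in>B. t \<le> card {a\<in>S. v \<in> F a}}) \<le> c * real (card S)"
  defines "\<delta> \<equiv> \<lambda>v. {a\<in>A. v \<in> F a}"
  shows "(\<Sum>v\<in>B. \<kappa> * (\<rho> * real (card (\<delta> v)) - real t * p v) - \<kappa>\<^sup>2 / 4 *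
      (\<rho> * real (card (\<delta> v)) + (\<Sum>a\<in>\<delta> v. \<Sum>a'\<in>\<delta> v - {a}. \<rho>\<^sup>2 / prod p (F a \<inter> F a'))))
    \<le> c * (\<rho> * real (card A))"
proof -
  define r where "r = (\<lambda>a. \<rho> / prod p (F a))"
  \<comment> \<open>One independent choice is made for each vertex (\<open>Inl v\<close>) and one
    for each hyperedge (\<open>Inr a\<close>). A hyperedge survives when its own choice and those of
    all its vertices succeed, which below is the event \<open>Z a \<subseteq> Y\<close>.\<close>
  define q where "q = case_sum p r"
  define X where "X = B <+> A"
  have finX: "finite X" using fin by (simp add: X_def)
  have finF: "finite (F a)" if "a \<in> A" for a using FB[OF that] fin finite_subset by blast
  have pF: "0 < prod p Q" if "Q \<subseteq> B" for Q using p that by (intro prod_pos) blast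
  have q01: "0 \<le> q x \<and> q x \<le> 1" if "x \<in> X" for x
    using that p \<rho> pF[OF FB] unfolding X_def q_def r_def
    by (auto simp: less_imp_le divide_le_eq)
  obtain w where w0: "\<And>Y. Y \<subseteq> X \<Longrightarrow> 0 \<le> w Y"
    and w: "\<And>Z. Z \<subseteq> X \<Longrightarrow> (\<Sum>Y\<in>Pow X. w Y * of_bool (Z \<subseteq> Y)) = prod q Z"
    using independent_random_subset[of X q, OF finX q01] by blast
  have q: "prod q (P <+> Q) = prod p P * prod r Q" if "finite P" "finite Q" for P Q
    using that by (simp add: q_def prod.Plus)
  define Z where "Z = (\<lambda>a. F a <+> {a})"
  have ZX: "Z a \<subseteq> X" if "a \<in> A" for a using FB that by (auto simp: Z_def X_def)
  have E1: "prod q (Z a) = \<rho>" if "a \<in> A" for a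
  proof -
    have "prod p (F a) \<noteq> 0" using pF[OF FB[OF that]] by simp
    then show ?thesis using finF[OF that] by (simp add: Z_def q r_def del: prod_zero_iff)
  qed
  \<comment> \<open>The survivals of two hyperedges are correlated only through shared vertices,
    whose choices are counted once. This is the source of the division by the product over
    \<open>F a \<inter> F a'\<close>.\<close>
  have E2: "prod q (Z a \<union> Z a') = \<rho>\<^sup>2 / prod p (F a \<inter> F a')" if "a \<in> A" "a' \<in> A" "a \<noteq> a'" for a a'
  proof -
    have "Z a \<union> Z a' = (F a \<union> F a') <+> {a, a'}" by (auto simp: Z_def)
    moreover have "prod p (F a \<union> F a') * prod p (F a \<inter> F a') = prod p (F a) * prod p (F a')"
      using finF that by (intro prod.union_inter)
    moreover have "prod p (F a) > 0" "prod p (F a') > 0" "prod p (F a \<inter> F a') > 0"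
      using that FB by (auto intro!: pF)
    moreover have "x * (\<rho> / u * (\<rho> / v)) = \<rho>\<^sup>2 / y" if "x * y = u * v" "u > 0" "v > 0" "y > 0" for x y u v
    proof -
      have "x = u * v / y" using that by (simp add: eq_divide_eq)
      then show ?thesis using that by (simp add: power2_eq_square)
    qed
    ultimately show ?thesis using that finF by (simp add: q r_def del: prod_zero_iff)
  qed
  have EZ: "(\<Sum>Y\<in>Pow X. w Y * of_bool (Z a \<subseteq> Y)) = \<rho>" if "a \<in> A" for a
    using w[OF ZX[OF that]] E1[OF that] by simp
  define x where "x = (\<lambda>v Y. \<Sum>a\<in>\<delta> v. (of_bool (Z a \<subseteq> Y) :: real))"
  have fin\<delta>: "finite (\<delta> v)" and \<delta>A: "\<delta> v \<subseteq> A" for v using fin by (auto simp: \<delta>_def)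
  have Ex: "(\<Sum>Y\<in>Pow X. w Y * x v Y) = \<rho> * real (card (\<delta> v))" for v
  proof -
    have "(\<Sum>Y\<in>Pow X. w Y * x v Y) = (\<Sum>a\<in>\<delta> v. \<Sum>Y\<in>Pow X. w Y * of_bool (Z a \<subseteq> Y))"
      unfolding x_def sum_distrib_left by (rule sum.swap)
    also have "\<dots> = (\<Sum>a\<in>\<delta> v. \<rho>)" using \<delta>A by (intro sum.cong refl EZ) blast
    finally show ?thesis by simp
  qed
  have Ex2: "(\<Sum>Y\<in>Pow X. w Y * (x v Y)\<^sup>2) =
      \<rho> * real (card (\<delta> v)) + (\<Sum>a\<in>\<delta> v. \<Sum>a'\<in>\<delta> v - {a}. \<rho>\<^sup>2 / prod p (F a \<inter> F a'))" for v
  proof -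
    have "(x v Y)\<^sup>2 = (\<Sum>a\<in>\<delta> v. \<Sum>a'\<in>\<delta> v. of_bool (Z a \<union> Z a' \<subseteq> Y))" for Y
      unfolding x_def power2_eq_square sum_product by (intro sum.cong) auto
    then have "(\<Sum>Y\<in>Pow X. w Y * (x v Y)\<^sup>2)
        = (\<Sum>Y\<in>Pow X. \<Sum>a\<in>\<delta> v. \<Sum>a'\<in>\<delta> v. w Y * of_bool (Z a \<union> Z a' \<subseteq> Y))"
      by (simp add: sum_distrib_left)
    also have "\<dots> = (\<Sum>a\<in>\<delta> v. \<Sum>Y\<in>Pow X. \<Sum>a'\<in>\<delta> v. w Y * of_bool (Z a \<union> Z a' \<subseteq> Y))"
      by (rule sum.swap)
    also have "\<dots> = (\<Sum>a\<in>\<delta> v. \<Sum>a'\<in>\<delta> v. \<Sum>Y\<in>Pow X. w Y * of_bool (Z a \<union> Z a' \<subseteq> Y))"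
      by (intro sum.cong sum.swap refl)
    also have "\<dots> = (\<Sum>a\<in>\<delta> v. \<Sum>a'\<in>\<delta> v. prod q (Z a \<union> Z a'))"
      using \<delta>A ZX by (intro sum.cong refl w Un_least) blast+
    also have "\<dots> = (\<Sum>a\<in>\<delta> v. \<rho> + (\<Sum>a'\<in>\<delta> v - {a}. \<rho>\<^sup>2 / prod p (F a \<inter> F a')))"
    proof (intro sum.cong refl)
      fix a assume a: "a \<in> \<delta> v"
      have "(\<Sum>a'\<in>\<delta> v. prod q (Z a \<union> Z a')) = prod q (Z a \<union> Z a) + (\<Sum>a'\<in>\<delta> v - {a}. prod q (Z a \<union> Z a'))"
        using fin\<delta> a by (rule sum.remove)
      also have "(\<Sum>a'\<in>\<delta> v - {a}. prod q (Z a \<union> Z a')) = (\<Sum>a'\<in>\<delta> v - {a}. \<rho>\<^sup>2 / prod p (F a \<inter> F a'))"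
        using a by (intro sum.cong refl E2) (auto simp: \<delta>_def)
      finally show "(\<Sum>a'\<in>\<delta> v. prod q (Z a \<union> Z a')) = \<rho> + (\<Sum>a'\<in>\<delta> v - {a}. \<rho>\<^sup>2 / prod p (F a \<inter> F a'))"
        using E1[of a] a by (simp add: \<delta>_def)
    qed
    finally show ?thesis by (simp add: sum.distrib)
  qed
  have Ev: "(\<Sum>Y\<in>Pow X. w Y * of_bool (Inl v \<in> Y)) = p v" if "v \<in> B" for v
    using w[of "{Inl v}"] that by (simp add: X_def q_def InlI)
  define S where "S = (\<lambda>Y. {a\<in>A. Z a \<subseteq> Y})"
  have xcard: "x v Y = real (card {a\<in>S Y. v \<in> F a})" for v Y
  proof -
    have "x v Y = real (card {a\<in>\<delta> v. Z a \<subseteq> Y})"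
      using fin\<delta>[of v] by (simp add: x_def sum.If_cases of_bool_def Int_def)
    also have "{a\<in>\<delta> v. Z a \<subseteq> Y} = {a\<in>S Y. v \<in> F a}" by (auto simp: S_def \<delta>_def)
    finally show ?thesis .
  qed
  have pointwise: "\<kappa> * (x v Y - real t * of_bool (Inl v \<in> Y)) - \<kappa>\<^sup>2 / 4 * (x v Y)\<^sup>2
      \<le> of_bool (t \<le> card {a\<in>S Y. v \<in> F a})" for v Y
  proof (cases "t \<le> card {a\<in>S Y. v \<in> F a}")
    case True
    have "0 \<le> (1 - \<kappa> * x v Y / 2)\<^sup>2" by simp
    then have "\<kappa> * x v Y - \<kappa>\<^sup>2 / 4 * (x v Y)\<^sup>2 \<le> 1"
      by (simp add: power2_diff power_mult_distrib power_divide)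
    moreover have "0 \<le> \<kappa> * (real t * of_bool (Inl v \<in> Y))" using \<kappa> by simp
    ultimately show ?thesis using True by (simp add: right_diff_distrib)
  next
    case False
    \<comment> \<open>If \<open>v\<close> is dropped, no hyperedge at \<open>v\<close> survives.
      Hence \<open>t\<close> is subtracted only when \<open>v\<close> is kept, and the expected loss
      is \<open>t * p v\<close> instead of \<open>t\<close>.\<close>
    have "x v Y \<le> real t * of_bool (Inl v \<in> Y)"
    proof (cases "Inl v \<in> Y")
      case True
      then show ?thesis using False by (simp add: xcard)
    next
      case nv: False
      then have e: "{a\<in>S Y. v \<in> F a} = {}" by (auto simp: S_def Z_def)
      have "x v Y = 0" unfolding xcard e by simp
      then show ?thesis by simp
    qed
    then have "\<kappa> * (x v Y - real t * of_bool (Inl v \<in> Y)) \<le> 0"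
      using \<kappa> by (simp add: mult_nonneg_nonpos)
    moreover have "0 \<le> \<kappa>\<^sup>2 / 4 * (x v Y)\<^sup>2" by simp
    ultimately show ?thesis using False by (smt (verit) of_bool_eq(1))
  qed
  have "(\<Sum>v\<in>B. \<kappa> * (\<rho> * real (card (\<delta> v)) - real t * p v) - \<kappa>\<^sup>2 / 4 *
      (\<rho> * real (card (\<delta> v)) + (\<Sum>a\<in>\<delta> v. \<Sum>a'\<in>\<delta> v - {a}. \<rho>\<^sup>2 / prod p (F a \<inter> F a'))))
     = (\<Sum>v\<in>B. \<Sum>Y\<in>Pow X. w Y * (\<kappa> * (x v Y - real t * of_bool (Inl v \<in> Y)) - \<kappa>\<^sup>2 / 4 * (x v Y)\<^sup>2))"
  proof (intro sum.cong refl)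
    fix v assume v: "v \<in> B"
    have "(\<Sum>Y\<in>Pow X. w Y * (\<kappa> * (x v Y - real t * of_bool (Inl v \<in> Y)) - \<kappa>\<^sup>2 / 4 * (x v Y)\<^sup>2))
      = (\<Sum>Y\<in>Pow X. \<kappa> * (w Y * x v Y) - \<kappa> * real t * (w Y * of_bool (Inl v \<in> Y)) - \<kappa>\<^sup>2 / 4 * (w Y * (x v Y)\<^sup>2))"
      by (intro sum.cong refl) (simp add: algebra_simps)
    also have "\<dots> = \<kappa> * (\<Sum>Y\<in>Pow X. w Y * x v Y) - \<kappa> * real t * (\<Sum>Y\<in>Pow X. w Y * of_bool (Inl v \<in> Y))
        - \<kappa>\<^sup>2 / 4 * (\<Sum>Y\<in>Pow X. w Y * (x v Y)\<^sup>2)"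
      by (simp only: sum_subtractf sum_distrib_left)
    finally show "\<kappa> * (\<rho> * real (card (\<delta> v)) - real t * p v) - \<kappa>\<^sup>2 / 4 *
      (\<rho> * real (card (\<delta> v)) + (\<Sum>a\<in>\<delta> v. \<Sum>a'\<in>\<delta> v - {a}. \<rho>\<^sup>2 / prod p (F a \<inter> F a')))
      = (\<Sum>Y\<in>Pow X. w Y * (\<kappa> * (x v Y - real t * of_bool (Inl v \<in> Y)) - \<kappa>\<^sup>2 / 4 * (x v Y)\<^sup>2))"
      unfolding Ex Ex2 Ev[OF v] by (simp add: right_diff_distrib mult.assoc)
  qed
  also have "\<dots> \<le> (\<Sum>v\<in>B. \<Sum>Y\<in>Pow X. w Y * of_bool (t \<le> card {a\<in>S Y. v \<in> F a}))"
    using pointwise w0 by (intro sum_mono mult_left_mono) auto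
  also have "\<dots> = (\<Sum>Y\<in>Pow X. \<Sum>v\<in>B. w Y * of_bool (t \<le> card {a\<in>S Y. v \<in> F a}))"
    by (rule sum.swap)
  also have "\<dots> = (\<Sum>Y\<in>Pow X. w Y * real (card {v\<in>B. t \<le> card {a\<in>S Y. v \<in> F a}}))"
    using fin by (intro sum.cong refl)
      (simp add: sum_distrib_left[symmetric] sum.If_cases of_bool_def Int_def)
  \<comment> \<open>The covering hypothesis is applied to the surviving hyperedges for each outcome
    \<open>Y\<close> and then averaged.\<close>
  also have "\<dots> \<le> (\<Sum>Y\<in>Pow X. w Y * (c * real (card (S Y))))"
    by (intro sum_mono mult_left_mono cov w0) (auto simp: S_def)
  also have "\<dots> = (\<Sum>Y\<in>Pow X. \<Sum>a\<in>A. c * (w Y * of_bool (Z a \<subseteq> Y)))"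
    using fin by (intro sum.cong refl)
      (simp add: sum_distrib_left[symmetric] S_def sum.If_cases of_bool_def Int_def)
  also have "\<dots> = (\<Sum>a\<in>A. c * (\<Sum>Y\<in>Pow X. w Y * of_bool (Z a \<subseteq> Y)))"
    by (subst sum.swap) (simp add: sum_distrib_left)
  also have "\<dots> = (\<Sum>a\<in>A. c * \<rho>)" using EZ by simp
  finally show ?thesis by (simp add: mult_ac)
qed

lemma sum_card_incidences:
  assumes "finite A" "finite B" "\<And>a. a \<in> A \<Longrightarrow> F a \<subseteq> B"
  shows "(\<Sum>v\<in>B. card {a\<in>A. v \<in> F a}) = (\<Sum>a\<in>A. card (F a))"
proof -
  have "(\<Sum>v\<in>B. card {a\<in>A. v \<in> F a}) = (\<Sum>a\<in>A. card {v\<in>B. v \<in> F a})"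
    using sum_multicount_gen[OF assms(2,1), of "\<lambda>v a. v \<in> F a"] by simp
  also have "\<dots> = (\<Sum>a\<in>A. card (F a))"
    using assms(3) by (intro sum.cong refl arg_cong[where f = card]) auto
  finally show ?thesis .
qed

text \<open>
  The second moment bound is applied with \<open>p v\<close> proportional to the degree of \<open>v\<close>, which makes
  the expected number of surviving hyperedges at a surviving vertex at most \<open>L\<close>; pairs of
  hyperedges meeting in more than one vertex are negligible because of the codegree condition.
\<close>

lemma almost_regular_hypergraph_uniformity_bound:
  fixes F1 F2 :: "'a \<Rightarrow> 'b set" and \<Delta> q c :: real
  assumes fin: "finite A1" "finite B" and F1: "\<And>a. a \<in> A1 \<Longrightarrow> F1 a \<subseteq> B \<and> card (F1 a) = t * K"
    and A2: "A2 \<subseteq> A1" "A2 \<noteq> {}" "card A1 \<le> 2 * card A2"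
    and F2: "\<And>a. a \<in> A2 \<Longrightarrow> F2 a \<subseteq> F1 a \<and> card (F2 a) = K"
    and deg_le: "\<And>v. v \<in> B \<Longrightarrow> real (card {a\<in>A1. v \<in> F1 a}) \<le> \<Delta>"
    and deg_ge: "\<And>a v. a \<in> A2 \<Longrightarrow> v \<in> F2 a \<Longrightarrow> \<Delta> / q\<^sup>2 \<le> real (card {a\<in>A1. v \<in> F1 a})"
    and codeg: "\<And>a v w. a \<in> A2 \<Longrightarrow> v \<in> F2 a \<Longrightarrow> w \<in> F2 a \<Longrightarrow> v \<noteq> w \<Longrightarrow>
      real (card {a\<in>A1. v \<in> F1 a \<and> w \<in> F1 a}) \<le> \<Delta> / q ^ (2 * K + 1)"
    and q: "1 \<le> q" "real K \<le> q" and t: "1 \<le> t" and \<Delta>: "8 * real t ^ 2 * q ^ (2 * K) \<le> \<Delta>"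
    and cov: "\<And>S. S \<subseteq> A2 \<Longrightarrow> real (card {v\<in>B. t \<le> card {a\<in>S. v \<in> F2 a}}) \<le> c * real (card S)"
  shows "3 * real K \<le> 256 * real t ^ 3 * c"
proof -
  \<comment> \<open>The constants \<open>L\<close> and \<open>\<kappa>\<close> are tuned so that the
    negative terms take up at most 5/8 of the main term \<open>\<kappa> * K * G\<close> at the end.
    The remaining 3/8, with \<open>\<kappa> = 1 / (32 * t ^ 3)\<close>, give the factor 256.\<close>
  define L where "L = 8 * real t ^ 2"
  define \<rho> where "\<rho> = L / \<Delta>"
  define d1 where "d1 = (\<lambda>v. real (card {a\<in>A1. v \<in> F1 a}))"
  define p where "p = (\<lambda>v. d1 v / \<Delta>)"
  define B2 where "B2 = (\<Union>a\<in>A2. F2 a)"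
  define \<delta> where "\<delta> = (\<lambda>v. {a\<in>A2. v \<in> F2 a})"
  define \<kappa> where "\<kappa> = 1 / (4 * real t * L)"
  have L: "L \<ge> 1" using t one_le_power[of "real t" 2] unfolding L_def by linarith
  have "1 \<le> L * q ^ (2 * K)" using L q one_le_power[of q "2 * K"] mult_mono[of 1 L 1 "q ^ (2 * K)"] by simp
  then have \<Delta>pos: "\<Delta> > 0" using \<Delta> unfolding L_def by linarith
  have \<rho>: "\<rho> > 0" using L \<Delta>pos by (simp add: \<rho>_def)
  have \<kappa>: "\<kappa> > 0" using L t by (simp add: \<kappa>_def)
  have finA2: "finite A2" using A2 fin finite_subset by blast
  have B2B: "B2 \<subseteq> B" using F1 F2 A2 unfolding B2_def by blast
  then have finB2: "finite B2" using fin finite_subset by blast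
  have qpos: "q > 0" using q by simp
  have pge: "1 / q\<^sup>2 \<le> p v" if "v \<in> B2" for v
  proof -
    from that obtain a where "a \<in> A2" "v \<in> F2 a" unfolding B2_def by blast
    then have "\<Delta> / q\<^sup>2 \<le> d1 v" unfolding d1_def by (rule deg_ge)
    then have "\<Delta> / q\<^sup>2 / \<Delta> \<le> d1 v / \<Delta>" using \<Delta>pos by (intro divide_right_mono) auto
    then show ?thesis using \<Delta>pos by (simp add: p_def)
  qed
  have ppos: "0 < p v" if "v \<in> B2" for v
    using pge[OF that] qpos by (meson less_le_trans zero_less_divide_1_iff zero_less_power)
  have ple: "p v \<le> 1" if "v \<in> B2" for v
    using deg_le[of v] that B2B \<Delta>pos by (auto simp: p_def d1_def)
  \<comment> \<open>Each factor is at least \<open>1 / q\<^sup>2\<close> by the lower degree bound.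
    Together with the size of \<open>\<Delta>\<close> this makes \<open>\<rho>\<close> an admissible
    survival probability.\<close>
  have prodge: "1 / q ^ (2 * K) \<le> prod p Q" if "Q \<subseteq> B2" "card Q \<le> K" for Q
  proof -
    have "q ^ (2 * card Q) \<le> q ^ (2 * K)" using that q by (intro power_increasing) auto
    then have "1 / q ^ (2 * K) \<le> 1 / q ^ (2 * card Q)" using qpos by (intro divide_left_mono) auto
    also have "\<dots> = (\<Prod>v\<in>Q. 1 / q\<^sup>2)" by (simp add: power_mult power_divide)
    also have "\<dots> \<le> prod p Q" using that pge qpos by (intro prod_mono) auto
    finally show ?thesis .
  qed
  have F2B2: "F2 a \<subseteq> B2" if "a \<in> A2" for a using that by (auto simp: B2_def)
  have finF2: "finite (F2 a)" if "a \<in> A2" for a using F2B2[OF that] finB2 finite_subset by blast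
  have \<rho>le: "\<rho> \<le> prod p (F2 a)" if "a \<in> A2" for a
  proof -
    have "\<rho> \<le> 1 / q ^ (2 * K)" using \<Delta> \<Delta>pos qpos by (simp add: \<rho>_def L_def field_simps)
    also have "\<dots> \<le> prod p (F2 a)" using F2[OF that] F2B2[OF that] by (intro prodge) auto
    finally show ?thesis .
  qed
  have "(\<Sum>v\<in>B2. \<kappa> * (\<rho> * real (card {a\<in>A2. v \<in> F2 a}) - real t * p v) - \<kappa>\<^sup>2 / 4 *
      (\<rho> * real (card {a\<in>A2. v \<in> F2 a}) + (\<Sum>a\<in>{a\<in>A2. v \<in> F2 a}. \<Sum>a'\<in>{a\<in>A2. v \<in> F2 a} - {a}.
        \<rho>\<^sup>2 / prod p (F2 a \<inter> F2 a')))) \<le> c * (\<rho> * real (card A2))"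
  proof (rule second_moment_covering_bound[where F = F2])
    fix S assume S: "S \<subseteq> A2"
    have "card {v\<in>B2. t \<le> card {a\<in>S. v \<in> F2 a}} \<le> card {v\<in>B. t \<le> card {a\<in>S. v \<in> F2 a}}"
      using B2B fin by (intro card_mono) auto
    then show "real (card {v\<in>B2. t \<le> card {a\<in>S. v \<in> F2 a}}) \<le> c * real (card S)"
      using cov[OF S] by linarith
  qed (use finA2 finB2 F2B2 ppos ple \<rho> \<rho>le \<kappa> in auto)
  then have key: "(\<Sum>v\<in>B2. \<kappa> * (\<rho> * real (card (\<delta> v)) - real t * p v) - \<kappa>\<^sup>2 / 4 *
      (\<rho> * real (card (\<delta> v)) + (\<Sum>a\<in>\<delta> v. \<Sum>a'\<in>\<delta> v - {a}. \<rho>\<^sup>2 / prod p (F2 a \<inter> F2 a'))))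
      \<le> c * (\<rho> * real (card A2))"
    by (simp only: \<delta>_def)
  have fin\<delta>: "finite (\<delta> v)" for v using finA2 by (simp add: \<delta>_def)
  have d2: "real (card (\<delta> v)) \<le> d1 v" for v
    unfolding d1_def \<delta>_def using A2 F2 fin by (intro of_nat_mono card_mono) auto
  have d1p: "\<rho> * d1 v = L * p v" for v by (simp add: \<rho>_def p_def)
  have \<rho>d2: "\<rho> * real (card (\<delta> v)) \<le> L * p v" for v
    using mult_left_mono[OF d2, of \<rho> v] \<rho> d1p[of v] by simp
  \<comment> \<open>Pairs meeting only in \<open>v\<close> contribute at most
    \<open>(L * p v)\<^sup>2 / p v\<close>. Any other pair shares one of at most \<open>K\<close>
    further vertices \<open>w\<close>. For each \<open>w\<close> the codegree bound saves
    \<open>q ^ (2 * K + 1)\<close>, while the product loses at most \<open>q ^ (2 * K)\<close>; the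
    spare factor \<open>q\<close> absorbs the \<open>K\<close> choices. Each of the two kinds
    contributes at most \<open>L\<^sup>2 * p v\<close>.\<close>
  have pair: "(\<Sum>a\<in>\<delta> v. \<Sum>a'\<in>\<delta> v - {a}. \<rho>\<^sup>2 / prod p (F2 a \<inter> F2 a')) \<le> 2 * L\<^sup>2 * p v" if v: "v \<in> B2" for v
  proof -
    let ?u = "\<rho>\<^sup>2 * q ^ (2 * K)"
    have term_le: "\<rho>\<^sup>2 / prod p (F2 a \<inter> F2 a') \<le> \<rho>\<^sup>2 / p v + (\<Sum>w\<in>F2 a - {v}. ?u * of_bool (w \<in> F2 a'))"
      if a: "a \<in> \<delta> v" "a' \<in> \<delta> v" for a a'
    proof (cases "F2 a \<inter> F2 a' = {v}")
      case True
      then show ?thesis using qpos by (simp add: sum_nonneg)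
    next
      case False
      have aA: "a \<in> A2" "v \<in> F2 a" "v \<in> F2 a'" using a by (auto simp: \<delta>_def)
      with False obtain w where w: "w \<in> F2 a - {v}" "w \<in> F2 a'" by blast
      have "1 / q ^ (2 * K) \<le> prod p (F2 a \<inter> F2 a')"
        using F2B2[OF aA(1)] F2[OF aA(1)] finF2[OF aA(1)]
        by (intro prodge) (auto intro: order_trans[OF card_mono[of "F2 a"]])
      then have "\<rho>\<^sup>2 / prod p (F2 a \<inter> F2 a') \<le> \<rho>\<^sup>2 / (1 / q ^ (2 * K))"
        using qpos by (intro divide_left_mono mult_pos_pos) (auto intro: less_le_trans[of 0 "1 / q ^ (2 * K)"])
      also have "\<dots> = ?u * of_bool (w \<in> F2 a')" using w by simp
      also have "\<dots> \<le> (\<Sum>w\<in>F2 a - {v}. ?u * of_bool (w \<in> F2 a'))"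
        using finF2[OF aA(1)] w qpos by (intro member_le_sum) auto
      finally show ?thesis using ppos[OF v] by (smt (verit) divide_nonneg_pos zero_le_power2)
    qed
    have inner: "(\<Sum>a'\<in>\<delta> v - {a}. \<rho>\<^sup>2 / prod p (F2 a \<inter> F2 a'))
        \<le> real (card (\<delta> v)) * (\<rho>\<^sup>2 / p v) + ?u * (real K * (\<Delta> / q ^ (2 * K + 1)))" if a: "a \<in> \<delta> v" for a
    proof -
      have aA: "a \<in> A2" "v \<in> F2 a" using a by (auto simp: \<delta>_def)
      have "(\<Sum>a'\<in>\<delta> v - {a}. \<rho>\<^sup>2 / prod p (F2 a \<inter> F2 a'))
          \<le> (\<Sum>a'\<in>\<delta> v - {a}. \<rho>\<^sup>2 / p v + (\<Sum>w\<in>F2 a - {v}. ?u * of_bool (w \<in> F2 a')))"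
        using a by (intro sum_mono term_le) auto
      also have "\<dots> \<le> (\<Sum>a'\<in>\<delta> v. \<rho>\<^sup>2 / p v + (\<Sum>w\<in>F2 a - {v}. ?u * of_bool (w \<in> F2 a')))"
        using fin\<delta> ppos[OF v] qpos by (intro sum_mono2 add_nonneg_nonneg sum_nonneg) auto
      also have "\<dots> = real (card (\<delta> v)) * (\<rho>\<^sup>2 / p v) + (\<Sum>w\<in>F2 a - {v}. \<Sum>a'\<in>\<delta> v. ?u * of_bool (w \<in> F2 a'))"
        unfolding sum.distrib by (subst (2) sum.swap) simp
      also have "(\<Sum>w\<in>F2 a - {v}. \<Sum>a'\<in>\<delta> v. ?u * of_bool (w \<in> F2 a'))
          \<le> (\<Sum>w\<in>F2 a - {v}. ?u * (\<Delta> / q ^ (2 * K + 1)))"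
      proof (rule sum_mono)
        fix w assume w: "w \<in> F2 a - {v}"
        have "(\<Sum>a'\<in>\<delta> v. ?u * of_bool (w \<in> F2 a')) = ?u * real (card {a'\<in>\<delta> v. w \<in> F2 a'})"
          using fin\<delta>[of v] by (simp add: sum_distrib_left[symmetric] of_bool_def sum.If_cases Int_def)
        also have "card {a'\<in>\<delta> v. w \<in> F2 a'} \<le> card {a\<in>A1. v \<in> F1 a \<and> w \<in> F1 a}"
          using A2 F2 fin by (intro card_mono) (auto simp: \<delta>_def)
        then have "?u * real (card {a'\<in>\<delta> v. w \<in> F2 a'}) \<le> ?u * (\<Delta> / q ^ (2 * K + 1))"
          using codeg[OF aA, of w] w qpos by (intro mult_left_mono) auto
        finally show "(\<Sum>a'\<in>\<delta> v. ?u * of_bool (w \<in> F2 a')) \<le> ?u * (\<Delta> / q ^ (2 * K + 1))" .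
      qed
      also have "\<dots> = ?u * (real (card (F2 a - {v})) * (\<Delta> / q ^ (2 * K + 1)))" by simp
      also have "\<dots> \<le> ?u * (real K * (\<Delta> / q ^ (2 * K + 1)))"
        using F2[OF aA(1)] finF2[OF aA(1)] aA(2) qpos \<Delta>pos
        by (intro mult_left_mono mult_right_mono) auto
      finally show ?thesis by simp
    qed
    have "?u * (real K * (\<Delta> / q ^ (2 * K + 1))) = \<rho>\<^sup>2 * \<Delta> * (real K / q)"
      using qpos by (simp add: field_simps)
    also have "\<dots> \<le> \<rho>\<^sup>2 * \<Delta> * 1" using q qpos \<Delta>pos by (intro mult_left_mono) auto
    also have "\<dots> = \<rho> * L" using \<Delta>pos by (simp add: \<rho>_def power2_eq_square)
    finally have u: "?u * (real K * (\<Delta> / q ^ (2 * K + 1))) \<le> \<rho> * L" .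
    have "(\<Sum>a\<in>\<delta> v. \<Sum>a'\<in>\<delta> v - {a}. \<rho>\<^sup>2 / prod p (F2 a \<inter> F2 a'))
        \<le> (\<Sum>a\<in>\<delta> v. real (card (\<delta> v)) * (\<rho>\<^sup>2 / p v) + \<rho> * L)"
      using inner u by (intro sum_mono) (smt (verit))
    also have "\<dots> = (\<rho> * real (card (\<delta> v)))\<^sup>2 / p v + (\<rho> * real (card (\<delta> v))) * L"
      by (simp add: power2_eq_square algebra_simps)
    also have "\<dots> \<le> (L * p v)\<^sup>2 / p v + (L * p v) * L"
      using \<rho>d2[of v] \<rho> ppos[OF v] L by (intro add_mono divide_right_mono power_mono mult_right_mono) auto
    also have "\<dots> = 2 * L\<^sup>2 * p v" using ppos[OF v] by (simp add: power2_eq_square)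
    finally show ?thesis .
  qed
  define P where "P = (\<Sum>v\<in>B2. p v)"
  have s2: "(\<Sum>v\<in>B2. real (card (\<delta> v))) = real K * real (card A2)"
  proof -
    have "(\<Sum>v\<in>B2. card (\<delta> v)) = (\<Sum>a\<in>A2. card (F2 a))"
      unfolding \<delta>_def using finA2 finB2 F2B2 by (rule sum_card_incidences)
    also have "\<dots> = card A2 * K" using F2 by simp
    finally show ?thesis by (metis mult.commute of_nat_mult of_nat_sum)
  qed
  \<comment> \<open>The total weight \<open>P\<close> is compared with the incidences of
    \<open>F2\<close>. Passing from \<open>K\<close> to \<open>t * K\<close> vertices per hyperedge
    costs a factor \<open>t\<close>, and passing from \<open>A2\<close> to \<open>A1\<close> costs a
    factor 2.\<close>
  have "(\<Sum>v\<in>B2. d1 v) \<le> (\<Sum>v\<in>B. d1 v)" using B2B fin by (intro sum_mono2) (auto simp: d1_def)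
  also have "\<dots> = real (\<Sum>v\<in>B. card {a\<in>A1. v \<in> F1 a})" by (simp add: d1_def)
  also have "(\<Sum>v\<in>B. card {a\<in>A1. v \<in> F1 a}) = card A1 * (t * K)"
    using sum_card_incidences[OF fin, of F1] F1 by simp
  also have "real (card A1 * (t * K)) \<le> real (2 * card A2 * (t * K))"
    using A2(3) by (intro of_nat_mono mult_right_mono) auto
  finally have "(\<Sum>v\<in>B2. d1 v) / \<Delta> \<le> real (2 * card A2 * (t * K)) / \<Delta>"
    using \<Delta>pos by (intro divide_right_mono) auto
  then have PL: "P * L \<le> 2 * real t * (\<rho> * (real K * real (card A2)))"
    using L mult_right_mono[of P "real (2 * card A2 * (t * K)) / \<Delta>" L]
    by (simp add: P_def p_def sum_divide_distrib \<rho>_def mult_ac)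
  have "(\<Sum>v\<in>B2. \<kappa> * \<rho> * real (card (\<delta> v)) - (\<kappa> * real t + \<kappa>\<^sup>2 / 4 * (3 * L\<^sup>2)) * p v) \<le> c * (\<rho> * real (card A2))"
  proof (rule order_trans[OF sum_mono key])
    fix v assume v: "v \<in> B2"
    have "L * 1 * p v \<le> L * L * p v" using L ppos[OF v] by (intro mult_left_mono mult_right_mono) auto
    then have "\<rho> * real (card (\<delta> v)) + (\<Sum>a\<in>\<delta> v. \<Sum>a'\<in>\<delta> v - {a}. \<rho>\<^sup>2 / prod p (F2 a \<inter> F2 a')) \<le> 3 * L\<^sup>2 * p v"
      using \<rho>d2[of v] pair[OF v] by (simp add: power2_eq_square)
    then have "\<kappa>\<^sup>2 / 4 * (\<rho> * real (card (\<delta> v)) + (\<Sum>a\<in>\<delta> v. \<Sum>a'\<in>\<delta> v - {a}. \<rho>\<^sup>2 / prod p (F2 a \<inter> F2 a')))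
      \<le> \<kappa>\<^sup>2 / 4 * (3 * L\<^sup>2 * p v)" by (intro mult_left_mono) auto
    then show "\<kappa> * \<rho> * real (card (\<delta> v)) - (\<kappa> * real t + \<kappa>\<^sup>2 / 4 * (3 * L\<^sup>2)) * p v \<le>
       \<kappa> * (\<rho> * real (card (\<delta> v)) - real t * p v) - \<kappa>\<^sup>2 / 4 *
      (\<rho> * real (card (\<delta> v)) + (\<Sum>a\<in>\<delta> v. \<Sum>a'\<in>\<delta> v - {a}. \<rho>\<^sup>2 / prod p (F2 a \<inter> F2 a')))"
      by (simp add: algebra_simps)
  qed
  then have main: "\<kappa> * \<rho> * (real K * real (card A2)) - (\<kappa> * real t + \<kappa>\<^sup>2 / 4 * (3 * L\<^sup>2)) * P \<le> c * (\<rho> * real (card A2))"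
    unfolding sum_subtractf sum_distrib_left[symmetric] s2 P_def .
  define G where "G = \<rho> * real (card A2)"
  have G: "G > 0" using \<rho> A2(2) finA2 by (simp add: G_def card_gt_0_iff)
  have kL: "\<kappa> * L = 1 / (4 * real t)" using L by (simp add: \<kappa>_def)
  have co: "\<kappa> * real t + \<kappa>\<^sup>2 / 4 * (3 * L\<^sup>2) = \<kappa> * L * (real t / L + 3 * (\<kappa> * L) / 4)"
    using L by (simp add: field_simps power2_eq_square)
  have "real t / L = 1 / (8 * real t)" using t by (simp add: L_def power2_eq_square)
  then have "\<kappa> * real t + \<kappa>\<^sup>2 / 4 * (3 * L\<^sup>2) = \<kappa> * L * (5 / (16 * real t))"
    unfolding co unfolding kL using t by (simp add: field_simps)
  then have "(\<kappa> * real t + \<kappa>\<^sup>2 / 4 * (3 * L\<^sup>2)) * P = \<kappa> * (5 / (16 * real t)) * (P * L)" by simp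
  also have "\<dots> \<le> \<kappa> * (5 / (16 * real t)) * (2 * real t * (real K * G))"
    using PL \<kappa> t by (intro mult_left_mono) (auto simp: G_def mult_ac)
  also have "\<dots> = 5 / 8 * (\<kappa> * (real K * G))" using t by simp
  finally have "(\<kappa> * real t + \<kappa>\<^sup>2 / 4 * (3 * L\<^sup>2)) * P \<le> 5 / 8 * (\<kappa> * (real K * G))" .
  moreover have "\<kappa> * \<rho> * (real K * real (card A2)) = \<kappa> * (real K * G)" by (simp add: G_def)
  ultimately have "3 / 8 * (\<kappa> * (real K * G)) \<le> c * G" using main unfolding G_def by linarith
  then have "\<kappa> * (3 / 8) * real K * G \<le> c * G" by simp
  then have "\<kappa> * (3 / 8) * real K \<le> c" using G by simp
  moreover have "\<kappa> = 1 / (32 * real t ^ 3)" by (simp add: \<kappa>_def L_def power2_eq_square power3_eq_cube)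
  ultimately show ?thesis using t by (simp add: field_simps)
qed

section \<open>Selection and counting lemmas for thinning out hypergraphs\<close>

lemma independent_subset_of_card:
  assumes "finite X" and t: "t \<ge> 1" and sym: "\<And>x y. R x y \<Longrightarrow> R y x"
    and deg: "\<And>x. x \<in> X \<Longrightarrow> card {y\<in>X. y \<noteq> x \<and> R x y} < t" and "t * K \<le> card X"
  shows "\<exists>I\<subseteq>X. card I = K \<and> (\<forall>x\<in>I. \<forall>y\<in>I. x \<noteq> y \<longrightarrow> \<not> R x y)"
  using assms(1,4,5)
proof (induction K arbitrary: X)
  case 0
  then show ?case by (intro exI[of _ "{}"]) auto
next
  case (Suc K)
  show ?case
  proof (cases "X = {}")
    case True
    then show ?thesis using Suc.prems(3) t by simp
  next
    case False
    then obtain x where x: "x \<in> X" by blast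
    let ?N = "{y\<in>X. y \<noteq> x \<and> R x y}"
    \<comment> \<open>Greedy choice: each chosen element removes itself and fewer than
      \<open>t\<close> neighbours, hence at most \<open>t\<close> elements.\<close>
    define X' where "X' = X - insert x ?N"
    have "card (insert x ?N) \<le> t"
      using Suc.prems(1) Suc.prems(2)[OF x] by (simp add: card_insert_if)
    moreover have "card X' = card X - card (insert x ?N)"
      unfolding X'_def using x Suc.prems(1) by (intro card_Diff_subset) auto
    ultimately have "t * K \<le> card X'" using Suc.prems(3) by simp
    moreover have "card {z\<in>X'. z \<noteq> y \<and> R y z} < t" if "y \<in> X'" for y
    proof -
      have "card {z\<in>X'. z \<noteq> y \<and> R y z} \<le> card {z\<in>X. z \<noteq> y \<and> R y z}"
        using Suc.prems(1) by (intro card_mono) (auto simp: X'_def)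
      also have "\<dots> < t" using that by (intro Suc.prems(2)) (auto simp: X'_def)
      finally show ?thesis .
    qed
    moreover have "finite X'" using Suc.prems(1) by (simp add: X'_def)
    ultimately obtain I where I: "I \<subseteq> X'" "card I = K" "\<forall>x\<in>I. \<forall>y\<in>I. x \<noteq> y \<longrightarrow> \<not> R x y"
      using Suc.IH by blast
    have "finite I" using I(1) \<open>finite X'\<close> by (rule finite_subset)
    then have "card (insert x I) = Suc K"
      using I by (subst card_insert_disjoint) (auto simp: X'_def)
    moreover have "\<forall>u\<in>insert x I. \<forall>y\<in>insert x I. u \<noteq> y \<longrightarrow> \<not> R u y"
      using I sym unfolding X'_def by blast
    moreover have "insert x I \<subseteq> X" using I x by (auto simp: X'_def)
    ultimately show ?thesis by blast
  qed
qed

text \<open>Union bound over the \<open>t\<close>-subsets of \<open>H\<close>, of which there are at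
  most \<open>card H ^ t\<close>.\<close>

lemma card_large_intersection_le:
  assumes "finite A" "finite H"
    and free: "\<And>T. T \<subseteq> H \<Longrightarrow> card T = t \<Longrightarrow> card {a\<in>A. T \<subseteq> F a} \<le> s"
  shows "card {a\<in>A. t \<le> card (F a \<inter> H)} \<le> card H ^ t * s"
proof -
  let ?T = "{T. T \<subseteq> H \<and> card T = t}"
  have finT: "finite ?T" using assms(2) by simp
  have cT: "card ?T \<le> card H ^ t"
  proof (cases "t \<le> card H")
    case True
    then show ?thesis using n_subsets[OF assms(2)] binomial_le_pow by metis
  next
    case False
    then have e: "?T = {}" using card_mono[OF assms(2)] by auto
    show ?thesis unfolding e by simp
  qed
  have "{a\<in>A. t \<le> card (F a \<inter> H)} \<subseteq> (\<Union>T\<in>?T. {a\<in>A. T \<subseteq> F a})"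
  proof
    fix a assume a: "a \<in> {a\<in>A. t \<le> card (F a \<inter> H)}"
    then obtain T where "T \<subseteq> F a \<inter> H" "card T = t"
      by (metis (no_types, lifting) mem_Collect_eq obtain_subset_with_card_n)
    then show "a \<in> (\<Union>T\<in>?T. {a\<in>A. T \<subseteq> F a})" using a by auto
  qed
  then have "card {a\<in>A. t \<le> card (F a \<inter> H)} \<le> card (\<Union>T\<in>?T. {a\<in>A. T \<subseteq> F a})"
    using assms(1) finT by (intro card_mono) auto
  also have "\<dots> \<le> (\<Sum>T\<in>?T. card {a\<in>A. T \<subseteq> F a})" using finT by (rule card_UN_le)
  also have "\<dots> \<le> card ?T * s" using free by (intro sum_bounded_above[of _ _ s, simplified]) auto
  also have "\<dots> \<le> card H ^ t * s" using cT by simp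
  finally show ?thesis .
qed

lemma pigeonhole_level:
  fixes J :: nat
  assumes "finite X" "\<And>x. x \<in> X \<Longrightarrow> f x \<le> J"
  shows "\<exists>j\<le>J. card X \<le> Suc J * card {x\<in>X. f x = j}"
proof (rule ccontr)
  assume "\<not> ?thesis"
  then have less: "\<And>j. j \<le> J \<Longrightarrow> Suc J * card {x\<in>X. f x = j} < card X" by force
  have "card X = card (\<Union>j\<in>{..J}. {x\<in>X. f x = j})" using assms by (intro arg_cong[where f = card]) auto
  also have "\<dots> \<le> (\<Sum>j\<le>J. card {x\<in>X. f x = j})" by (intro card_UN_le) simp
  finally have "Suc J * card X \<le> (\<Sum>j\<le>J. Suc J * card {x\<in>X. f x = j})"
    by (metis mult_le_mono2 sum_distrib_left)
  also have "\<dots> < (\<Sum>j\<le>J. card X)" using less by (intro sum_strict_mono) auto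
  finally show False by simp
qed


lemma power_level:
  fixes q x :: real
  assumes "1 < q" "1 \<le> x" "x \<le> q ^ J"
  shows "\<exists>j\<le>J. q ^ j \<le> x \<and> x < q ^ Suc j"
  using assms(3)
proof (induction J)
  case 0
  then show ?case using assms by (intro exI[of _ 0]) auto
next
  case (Suc J)
  show ?case
  proof (cases "x \<le> q ^ J")
    case True
    with Suc.IH show ?thesis using le_Suc_eq by blast
  next
    case False
    show ?thesis
    proof (cases "x < q ^ Suc J")
      case True
      then show ?thesis using False by (intro exI[of _ J]) auto
    next
      case False
      have "q ^ Suc J < q ^ Suc (Suc J)" using assms(1) by (intro power_strict_increasing) auto
      with False Suc.prems show ?thesis by (intro exI[of _ "Suc J"]) linarith
    qed
  qed
qed

text \<open>
  The window of degrees between \<open>q ^ j\<close> and \<open>q ^ Suc j\<close> is one of boundedly many since \<open>q\<close> is a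
  fixed root of \<open>n\<close>. A vertex has few heavy partners (codegree above \<open>\<theta>\<close>), so by freeness few
  hyperedges at it contain \<open>t\<close> of them; in the other hyperedges the heavy pairs form a graph of
  maximum degree below \<open>t\<close>.
\<close>

lemma no_dense_uniform_hypergraph:
  fixes F :: "'a \<Rightarrow> 'b set" and q c :: real and t K N J D n :: nat
  assumes t: "1 \<le> t" and K: "1 \<le> K" "256 * real t ^ 3 * c < 3 * real K"
    and N: "N = 2 * (t * (2 * K + 1))" and J: "J = 2 * N" and D: "D = Suc J * (t * K)"
    and fin: "finite A" "finite B" and n: "card B = n" "card A = n\<^sup>2"
    and F: "\<And>a. a \<in> A \<Longrightarrow> F a \<subseteq> B \<and> card (F a) = D"
    and cov: "\<And>S. S \<subseteq> A \<Longrightarrow> real (card {v\<in>B. t \<le> card {a\<in>S. v \<in> F a}}) \<le> c * real (card S)"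
    and free: "\<And>T. T \<subseteq> B \<Longrightarrow> card T = t \<Longrightarrow> card {a\<in>A. T \<subseteq> F a} \<le> t"
    and qn: "q ^ N = real n" and q1: "1 < q" and qK: "real K \<le> q"
    and qD: "4 * real (Suc J) * real D \<le> q" and qt: "4 * real (Suc J) * (real t * real (t * K) ^ t) \<le> q"
    and qL: "8 * real t ^ 2 * real (Suc J) \<le> q"
  shows False
proof -
  define e where "e = 2 * K + 1"
  have qpos: "q > 0" using q1 by simp
  have n0: "n > 0" using qn qpos by (metis of_nat_0_less_iff zero_less_power)
  define deg0 where "deg0 = (\<lambda>v. card {a\<in>A. v \<in> F a})"
  \<comment> \<open>Degrees are at most \<open>card A = n\<^sup>2\<close>, and
    \<open>J = 2 * N\<close> makes this \<open>q ^ J\<close>. So there are only \<open>Suc J\<close>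
    levels, a number independent of \<open>n\<close>.\<close>
  have "q ^ J = real n ^ 2" unfolding J qn[symmetric] by (simp add: power_mult mult.commute)
  have lev_ex: "\<exists>j\<le>J. q ^ j \<le> real (deg0 v) \<and> real (deg0 v) < q ^ Suc j" if "deg0 v > 0" for v
  proof (rule power_level[OF q1])
    show "1 \<le> real (deg0 v)" using that by simp
    have "deg0 v \<le> card A" unfolding deg0_def using fin by (intro card_mono) auto
    then show "real (deg0 v) \<le> q ^ J" using \<open>q ^ J = _\<close> n by (metis of_nat_le_iff of_nat_power)
  qed
  define lev where "lev = (\<lambda>v. SOME j. j \<le> J \<and> q ^ j \<le> real (deg0 v) \<and> real (deg0 v) < q ^ Suc j)"
  have lev: "lev v \<le> J" "q ^ lev v \<le> real (deg0 v)" "real (deg0 v) < q ^ Suc (lev v)" if "deg0 v > 0" for v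
    using someI_ex[OF lev_ex[OF that]] unfolding lev_def by blast+
  have d0: "deg0 v > 0" if "a \<in> A" "v \<in> F a" for a v
    using that fin by (auto simp: deg0_def card_gt_0_iff)
  have finF: "finite (F a)" if "a \<in> A" for a using F[OF that] fin finite_subset by blast
  \<comment> \<open>Two pigeonhole steps follow. Since \<open>D = Suc J * (t * K)\<close>, each
    hyperedge has \<open>t * K\<close> vertices on one level. A single level \<open>j\<close> then
    serves at least the fraction \<open>1 / Suc J\<close> of all hyperedges.\<close>
  have "\<exists>j\<le>J. t * K \<le> card {v\<in>F a. lev v = j}" if a: "a \<in> A" for a
  proof -
    obtain j where "j \<le> J" "card (F a) \<le> Suc J * card {v\<in>F a. lev v = j}"
      using pigeonhole_level[OF finF[OF a], of lev J] lev d0[OF a] by blast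
    then show ?thesis using F[OF a] unfolding D by (metis Suc_mult_le_cancel1)
  qed
  then obtain g where g: "\<And>a. a \<in> A \<Longrightarrow> g a \<le> J" "\<And>a. a \<in> A \<Longrightarrow> t * K \<le> card {v\<in>F a. lev v = g a}"
    by metis
  obtain j where j: "j \<le> J" "card A \<le> Suc J * card {a\<in>A. g a = j}"
    using pigeonhole_level[OF fin(1), of g J] g(1) by blast
  define A1 where "A1 = {a\<in>A. g a = j}"
  have A1A: "A1 \<subseteq> A" and finA1: "finite A1" using fin by (auto simp: A1_def)
  have A1: "real n ^ 2 \<le> real (Suc J) * real (card A1)"
  proof -
    have "real (n\<^sup>2) \<le> real (Suc J * card A1)" using j(2) n unfolding A1_def by (intro of_nat_mono) simp
    then show ?thesis by (simp only: of_nat_power of_nat_mult)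
  qed
  have "\<forall>a\<in>A1. \<exists>Q. Q \<subseteq> {v\<in>F a. lev v = j} \<and> card Q = t * K"
  proof
    fix a assume "a \<in> A1"
    then have "t * K \<le> card {v\<in>F a. lev v = j}" using g(2)[of a] by (simp add: A1_def)
    then show "\<exists>Q. Q \<subseteq> {v\<in>F a. lev v = j} \<and> card Q = t * K"
      using obtain_subset_with_card_n by metis
  qed
  then obtain F1 where F1: "\<And>a. a \<in> A1 \<Longrightarrow> F1 a \<subseteq> {v\<in>F a. lev v = j}" "\<And>a. a \<in> A1 \<Longrightarrow> card (F1 a) = t * K"
    by metis
  define \<Delta> where "\<Delta> = q ^ Suc j"
  have \<Delta>: "\<Delta> > 0" using qpos by (simp add: \<Delta>_def)
  define W where "W = {v\<in>B. deg0 v > 0 \<and> lev v = j}"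
  have finW: "finite W" and WB: "W \<subseteq> B" using fin by (auto simp: W_def)
  have cW: "card W \<le> n" using WB fin n card_mono by blast
  have F1W: "F1 a \<subseteq> W" if "a \<in> A1" for a
    using F1(1)[OF that] F that d0 A1A unfolding W_def by blast
  have finF1: "finite (F1 a)" if "a \<in> A1" for a using F1W[OF that] finW finite_subset by blast
  define deg1 where "deg1 = (\<lambda>v. card {a\<in>A1. v \<in> F1 a})"
  have deg10: "deg1 v \<le> deg0 v" for v
    unfolding deg1_def deg0_def using fin A1A F1 by (intro card_mono) auto
  have deg1: "real (deg1 v) \<le> \<Delta>" if "v \<in> W" for v
    using deg10[of v] lev(3)[of v] that unfolding W_def \<Delta>_def by auto
  have sum1: "(\<Sum>v\<in>W. deg1 v) = card A1 * (t * K)"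
    unfolding deg1_def using sum_card_incidences[OF finA1 finW, of F1] F1W F1 by simp
  have Wq: "real (card W) * q ^ j \<le> real n ^ 2 * real D"
  proof -
    have "real (card W) * q ^ j = (\<Sum>v\<in>W. q ^ j)" by simp
    also have "\<dots> \<le> (\<Sum>v\<in>W. real (deg0 v))" using lev(2) by (intro sum_mono) (auto simp: W_def)
    also have "\<dots> \<le> (\<Sum>v\<in>B. real (deg0 v))" using WB fin by (intro sum_mono2) auto
    also have "\<dots> = real (\<Sum>v\<in>B. deg0 v)" by simp
    also have "(\<Sum>v\<in>B. deg0 v) = n\<^sup>2 * D"
      unfolding deg0_def using sum_card_incidences[OF fin, of F] F n by simp
    finally show ?thesis by simp
  qed
  \<comment> \<open>These hyperedges contain a vertex whose degree dropped too far in passing from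
    \<open>F\<close> to \<open>F1\<close>. By \<open>Wq\<close> there are at most
    \<open>n\<^sup>2 * D / q ^ j\<close> vertices in \<open>W\<close>. Each such low-degree vertex
    spoils fewer than \<open>\<Delta> / q\<^sup>2 = q ^ j / q\<close> hyperedges, so the factor
    \<open>1 / q\<close> outweighs the constants.\<close>
  define D1 where "D1 = {a\<in>A1. \<exists>v\<in>F1 a. real (deg1 v) < \<Delta> / q\<^sup>2}"
  have D1: "4 * real (card D1) \<le> real (card A1)"
  proof -
    have "D1 \<subseteq> (\<Union>v\<in>{v\<in>W. real (deg1 v) < \<Delta> / q\<^sup>2}. {a\<in>A1. v \<in> F1 a})"
      using F1W unfolding D1_def by blast
    then have "card D1 \<le> card (\<Union>v\<in>{v\<in>W. real (deg1 v) < \<Delta> / q\<^sup>2}. {a\<in>A1. v \<in> F1 a})"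
      using finW finA1 by (intro card_mono) auto
    also have "\<dots> \<le> (\<Sum>v\<in>{v\<in>W. real (deg1 v) < \<Delta> / q\<^sup>2}. deg1 v)"
      unfolding deg1_def using finW by (intro card_UN_le) auto
    finally have "real (card D1) \<le> (\<Sum>v\<in>{v\<in>W. real (deg1 v) < \<Delta> / q\<^sup>2}. real (deg1 v))"
      by (metis of_nat_le_iff of_nat_sum)
    also have "\<dots> \<le> (\<Sum>v\<in>{v\<in>W. real (deg1 v) < \<Delta> / q\<^sup>2}. \<Delta> / q\<^sup>2)" by (intro sum_mono) auto
    also have "\<dots> \<le> (\<Sum>v\<in>W. \<Delta> / q\<^sup>2)" using finW \<Delta> by (intro sum_mono2) auto
    also have "\<dots> = real (card W) * q ^ j / q" using qpos by (simp add: \<Delta>_def power2_eq_square)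
    also have "\<dots> \<le> real n ^ 2 * real D / q" using Wq qpos by (intro divide_right_mono) auto
    finally have "real (card D1) * q \<le> real n ^ 2 * real D" using qpos by (simp add: field_simps)
    also have "\<dots> \<le> real (Suc J) * real (card A1) * real D" using A1 by (intro mult_right_mono) auto
    finally have "4 * (real (card D1) * q) \<le> 4 * (real (Suc J) * real (card A1) * real D)" by linarith
    also have "\<dots> = real (card A1) * (4 * real (Suc J) * real D)" by (simp only: mult_ac)
    also have "\<dots> \<le> real (card A1) * q" using qD by (intro mult_left_mono) auto
    finally show ?thesis using qpos by simp
  qed
  define codeg where "codeg = (\<lambda>v w. card {a\<in>A1. v \<in> F1 a \<and> w \<in> F1 a})"
  define \<theta> where "\<theta> = \<Delta> / q ^ e"
  have \<theta>: "\<theta> > 0" using \<Delta> qpos by (simp add: \<theta>_def)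
  define H where "H = (\<lambda>v. {w\<in>W. w \<noteq> v \<and> \<theta> < real (codeg v w)})"
  \<comment> \<open>The codegrees at \<open>v\<close> sum to \<open>deg1 v * (t * K)\<close>, at
    most \<open>\<Delta> * (t * K)\<close>, and each heavy partner uses up more than
    \<open>\<theta> = \<Delta> / q ^ e\<close> of this.\<close>
  have cH: "real (card (H v)) \<le> real (t * K) * q ^ e" if v: "v \<in> W" for v
  proof -
    have "real (card (H v)) * \<theta> = (\<Sum>w\<in>H v. \<theta>)" by simp
    also have "\<dots> \<le> (\<Sum>w\<in>H v. real (codeg v w))" by (intro sum_mono) (auto simp: H_def)
    also have "\<dots> \<le> (\<Sum>w\<in>W. real (codeg v w))" using finW by (intro sum_mono2) (auto simp: H_def)
    also have "\<dots> = real (\<Sum>w\<in>W. card {a\<in>{a\<in>A1. v \<in> F1 a}. w \<in> F1 a})" by (simp add: codeg_def)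
    also have "(\<Sum>w\<in>W. card {a\<in>{a\<in>A1. v \<in> F1 a}. w \<in> F1 a}) = deg1 v * (t * K)"
      using sum_card_incidences[of "{a\<in>A1. v \<in> F1 a}" W F1] finA1 finW F1W F1 by (simp add: deg1_def)
    also have "real (deg1 v * (t * K)) \<le> \<Delta> * real (t * K)"
      unfolding of_nat_mult[of "deg1 v"] using deg1[OF v] by (intro mult_right_mono) auto
    finally have "real (card (H v)) * \<theta> \<le> real (t * K) * q ^ e * \<theta>"
      using qpos by (simp add: \<theta>_def mult.commute)
    then show ?thesis using \<theta> by (rule mult_right_le_imp_le)
  qed
  define D2 where "D2 = {a\<in>A1. \<exists>v\<in>F1 a. t \<le> card (F1 a \<inter> H v)}"
  \<comment> \<open>The count is at most a constant times \<open>n * q ^ (t * e)\<close>. The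
    constant is absorbed by one further factor \<open>q\<close>, which is at most
    \<open>q ^ (t * e)\<close>. The choice \<open>N = 2 * (t * e)\<close> turns the total into
    \<open>n * q ^ N = n\<^sup>2\<close>.\<close>
  have D2: "4 * real (card D2) \<le> real (card A1)"
  proof -
    have "D2 \<subseteq> (\<Union>v\<in>W. {a\<in>A1. t \<le> card (F1 a \<inter> H v)})" using F1W unfolding D2_def by blast
    then have "card D2 \<le> card (\<Union>v\<in>W. {a\<in>A1. t \<le> card (F1 a \<inter> H v)})"
      using finW finA1 by (intro card_mono) auto
    also have "\<dots> \<le> (\<Sum>v\<in>W. card {a\<in>A1. t \<le> card (F1 a \<inter> H v)})"
      using finW by (intro card_UN_le) auto
    also have "\<dots> \<le> (\<Sum>v\<in>W. card (H v) ^ t * t)"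
    proof (intro sum_mono card_large_intersection_le)
      fix v T assume "v \<in> W" and T: "T \<subseteq> H v" "card T = t"
      then have "T \<subseteq> B" using WB by (auto simp: H_def)
      have "card {a\<in>A1. T \<subseteq> F1 a} \<le> card {a\<in>A. T \<subseteq> F a}"
        using A1A F1 fin by (intro card_mono) fastforce+
      also have "\<dots> \<le> t" using \<open>T \<subseteq> B\<close> T by (intro free)
      finally show "card {a\<in>A1. T \<subseteq> F1 a} \<le> t" .
    qed (use finA1 finW in \<open>auto simp: H_def\<close>)
    finally have "real (card D2) \<le> (\<Sum>v\<in>W. real (card (H v)) ^ t * real t)"
      by (metis (mono_tags, lifting) of_nat_le_iff of_nat_mult of_nat_power of_nat_sum sum.cong)
    also have "\<dots> \<le> (\<Sum>v\<in>W. (real (t * K) * q ^ e) ^ t * real t)"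
      using cH by (intro sum_mono mult_right_mono power_mono) auto
    also have "\<dots> = real (card W) * ((real (t * K) * q ^ e) ^ t * real t)" by simp
    also have "\<dots> \<le> real n * ((real (t * K) * q ^ e) ^ t * real t)"
      using cW qpos by (intro mult_right_mono) auto
    also have "\<dots> = real n * (real t * real (t * K) ^ t) * q ^ (t * e)"
      by (simp add: power_mult_distrib power_mult[symmetric] mult_ac)
    finally have "4 * real (Suc J) * real (card D2) \<le> 4 * real (Suc J) * (real n * (real t * real (t * K) ^ t) * q ^ (t * e))"
      by (intro mult_left_mono) auto
    also have "\<dots> = real n * q ^ (t * e) * (4 * real (Suc J) * (real t * real (t * K) ^ t))"
      by (simp only: mult_ac)
    also have "\<dots> \<le> real n * q ^ (t * e) * q" using qt qpos by (intro mult_left_mono) auto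
    also have "q \<le> q ^ (t * e)"
      using q1 t power_increasing[of 1 "t * e" q] by (simp add: e_def)
    then have "real n * q ^ (t * e) * q \<le> real n * q ^ (t * e) * q ^ (t * e)"
      using qpos by (intro mult_left_mono) auto
    also have "\<dots> = real n * q ^ N" unfolding N e_def[symmetric] by (simp add: mult_2 power_add)
    also have "\<dots> = real n ^ 2" by (simp add: qn power2_eq_square)
    also note A1
    finally have "real (Suc J) * (4 * real (card D2)) \<le> real (Suc J) * real (card A1)" by (simp only: mult_ac)
    then show ?thesis by (simp only: mult_le_cancel_left_pos of_nat_0_less_iff zero_less_Suc)
  qed
  define A2 where "A2 = A1 - D1 - D2"
  have "card A1 \<le> card A2 + card D1 + card D2"
  proof -
    have "A1 = A2 \<union> (D1 \<union> D2)" by (auto simp: A2_def D1_def D2_def)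
    then have "card A1 \<le> card A2 + card (D1 \<union> D2)" by (metis card_Un_le)
    also have "card (D1 \<union> D2) \<le> card D1 + card D2" by (rule card_Un_le)
    finally show ?thesis by simp
  qed
  with D1 D2 have A12: "card A1 \<le> 2 * card A2" by linarith
  have "0 < real n ^ 2" using n0 by simp
  with A1 have "0 < real (Suc J) * real (card A1)" by linarith
  then have "A1 \<noteq> {}" by auto
  then have "card A1 > 0" using finA1 by (simp add: card_gt_0_iff)
  with A12 have A2ne: "A2 \<noteq> {}" by auto
  have codeg_sym: "codeg v w = codeg w v" for v w
    unfolding codeg_def by (rule arg_cong[where f = card]) auto
  have "\<exists>I\<subseteq>F1 a. card I = K \<and> (\<forall>v\<in>I. \<forall>w\<in>I. v \<noteq> w \<longrightarrow> \<not> \<theta> < real (codeg v w))" if a: "a \<in> A2" for a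
  proof (rule independent_subset_of_card[OF _ t])
    have aA1: "a \<in> A1" using a by (simp add: A2_def)
    show "finite (F1 a)" using finF1[OF aA1] .
    show "t * K \<le> card (F1 a)" using F1(2)[OF aA1] by simp
    show "card {w\<in>F1 a. w \<noteq> v \<and> \<theta> < real (codeg v w)} < t" if v: "v \<in> F1 a" for v
    proof -
      have "{w\<in>F1 a. w \<noteq> v \<and> \<theta> < real (codeg v w)} = F1 a \<inter> H v"
        using F1W[OF aA1] by (auto simp: H_def)
      moreover have "\<not> t \<le> card (F1 a \<inter> H v)" using a v by (auto simp: A2_def D2_def)
      ultimately show ?thesis by simp
    qed
  qed (simp add: codeg_sym)
  then obtain F2 where F2: "\<And>a. a \<in> A2 \<Longrightarrow> F2 a \<subseteq> F1 a \<and> card (F2 a) = K \<and>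
      (\<forall>v\<in>F2 a. \<forall>w\<in>F2 a. v \<noteq> w \<longrightarrow> \<not> \<theta> < real (codeg v w))"
    by metis
  \<comment> \<open>Average degree: at least \<open>n\<^sup>2 / Suc J\<close> nonempty hyperedges
    lie on at most \<open>n\<close> vertices of degree at most \<open>\<Delta>\<close>. Since
    \<open>n = q ^ N\<close> and \<open>e \<le> N\<close>, this forces \<open>\<Delta>\<close> to
    exceed the required power of \<open>q\<close>.\<close>
  have n\<Delta>: "real n \<le> real (Suc J) * \<Delta>"
  proof -
    have "real n * real n \<le> real (Suc J) * real (card A1) * 1" using A1 by (simp add: power2_eq_square)
    also have "\<dots> \<le> real (Suc J) * real (card A1) * real (t * K)"
    proof (rule mult_left_mono)
      have "1 \<le> t * K" using t K by (simp add: Suc_le_eq)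
      then show "1 \<le> real (t * K)" by linarith
    qed simp
    also have "\<dots> = real (Suc J) * real (\<Sum>v\<in>W. deg1 v)" unfolding sum1 by simp
    also have "\<dots> \<le> real (Suc J) * (real n * \<Delta>)"
    proof (intro mult_left_mono)
      have "real (\<Sum>v\<in>W. deg1 v) \<le> (\<Sum>v\<in>W. \<Delta>)" unfolding of_nat_sum using deg1 by (intro sum_mono)
      also have "\<dots> = real (card W) * \<Delta>" by simp
      also have "\<dots> \<le> real n * \<Delta>" using cW \<Delta> by (intro mult_right_mono) auto
      finally show "real (\<Sum>v\<in>W. deg1 v) \<le> real n * \<Delta>" .
    qed simp
    finally have "real n * real n \<le> real n * (real (Suc J) * \<Delta>)" by (simp only: mult_ac)
    then show ?thesis using n0 by (simp only: mult_le_cancel_left_pos of_nat_0_less_iff)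
  qed
  have \<Delta>_ge: "8 * real t ^ 2 * q ^ (2 * K) \<le> \<Delta>"
  proof -
    have "1 * (2 * K + 1) \<le> 2 * t * (2 * K + 1)" using t by (intro mult_right_mono) auto
    then have eN: "e \<le> N" unfolding N e_def by simp
    have "real (Suc J) * (8 * real t ^ 2 * q ^ (2 * K)) = 8 * real t ^ 2 * real (Suc J) * q ^ (2 * K)"
      by (simp only: mult_ac)
    also have "\<dots> \<le> q * q ^ (2 * K)" using qL qpos by (intro mult_right_mono) auto
    also have "\<dots> = q ^ e" by (simp add: e_def)
    also have "\<dots> \<le> q ^ N" using q1 eN by (intro power_increasing) auto
    also have "\<dots> \<le> real (Suc J) * \<Delta>" using n\<Delta> qn by simp
    finally show ?thesis by (simp only: mult_le_cancel_left_pos of_nat_0_less_iff zero_less_Suc)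
  qed
  have cov2: "real (card {v\<in>W. t \<le> card {a\<in>S. v \<in> F2 a}}) \<le> c * real (card S)" if S: "S \<subseteq> A2" for S
  proof -
    have finS: "finite S" and SA: "S \<subseteq> A" "S \<subseteq> A1"
      using S finA1 A1A finite_subset[of S A1] by (auto simp: A2_def)
    have "F2 a \<subseteq> F a" if "a \<in> S" for a using that S SA F2[of a] F1(1)[of a] by blast
    then have "card {a\<in>S. v \<in> F2 a} \<le> card {a\<in>S. v \<in> F a}" for v
      using finS by (intro card_mono) auto
    then have "{v\<in>W. t \<le> card {a\<in>S. v \<in> F2 a}} \<subseteq> {v\<in>B. t \<le> card {a\<in>S. v \<in> F a}}"
      using WB order_trans by blast
    then have "card {v\<in>W. t \<le> card {a\<in>S. v \<in> F2 a}} \<le> card {v\<in>B. t \<le> card {a\<in>S. v \<in> F a}}"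
      using fin by (intro card_mono) auto
    then show ?thesis using cov[OF SA(1)] by linarith
  qed
  have "3 * real K \<le> 256 * real t ^ 3 * c"
  proof (rule almost_regular_hypergraph_uniformity_bound[of A1 W F1 t K A2 F2 \<Delta> q c])
    show "\<Delta> / q\<^sup>2 \<le> real (card {a\<in>A1. v \<in> F1 a})" if "a \<in> A2" "v \<in> F2 a" for a v
    proof -
      have "a \<in> A1" "a \<notin> D1" "v \<in> F1 a" using that F2[OF that(1)] by (auto simp: A2_def)
      then have "\<not> real (deg1 v) < \<Delta> / q\<^sup>2" unfolding D1_def by blast
      then show ?thesis unfolding deg1_def by simp
    qed
    show "real (card {a\<in>A1. v \<in> F1 a \<and> w \<in> F1 a}) \<le> \<Delta> / q ^ (2 * K + 1)"
      if "a \<in> A2" "v \<in> F2 a" "w \<in> F2 a" "v \<noteq> w" for a v w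
    proof -
      have "\<not> \<theta> < real (codeg v w)" using that F2[OF that(1)] by blast
      then show ?thesis unfolding codeg_def \<theta>_def e_def by simp
    qed
    show "real (card {a\<in>A1. v \<in> F1 a}) \<le> \<Delta>" if "v \<in> W" for v
      using deg1[OF that] by (simp add: deg1_def)
  qed (use finA1 finW F1W F1 A2ne A12 F2 q1 qK t \<Delta>_ge cov2 in \<open>auto simp: A2_def\<close>)
  with K(2) show False by linarith
qed

subsection \<open>Edge bounds\<close>

text \<open>If the bound failed, exactly \<open>(card B)\<^sup>2\<close> large hyperedges could be
  selected and each shrunk to exactly \<open>D\<close> vertices. Covering and freeness survive both
  operations, contradicting \<open>no_dense_uniform_hypergraph\<close>.\<close>

lemma card_large_hyperedges_le:
  fixes t :: nat and c :: real
  assumes t: "1 \<le> t"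
  shows "\<exists>D n0. \<forall>(A :: 'a set) (B :: 'b set) F. finite A \<longrightarrow> finite B \<longrightarrow> (\<forall>a\<in>A. F a \<subseteq> B) \<longrightarrow>
    (\<forall>S\<subseteq>A. real (card {v\<in>B. t \<le> card {a\<in>S. v \<in> F a}}) \<le> c * real (card S)) \<longrightarrow>
    (\<forall>T\<subseteq>B. card T = t \<longrightarrow> card {a\<in>A. T \<subseteq> F a} \<le> t) \<longrightarrow> n0 \<le> card B \<longrightarrow>
    card {a\<in>A. D \<le> card (F a)} \<le> (card B)\<^sup>2"
proof -
  \<comment> \<open>This uniformity is just large enough to violate
    \<open>3 * K \<le> 256 * t ^ 3 * c\<close>.\<close>
  define K where "K = nat \<lceil>256 * real t ^ 3 * c\<rceil> + 1"
  define N where "N = 2 * (t * (2 * K + 1))"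
  define J where "J = 2 * N"
  define D where "D = Suc J * (t * K)"
  \<comment> \<open>Sum of all lower bounds demanded of \<open>q\<close>. The threshold
    \<open>n0\<close> ensures that the \<open>N\<close>-th root of \<open>card B\<close> reaches
    it.\<close>
  define Q where "Q = real K + 4 * real (Suc J) * real D + 4 * real (Suc J) * (real t * real (t * K) ^ t)
    + 8 * real t ^ 2 * real (Suc J) + 2"
  define n0 where "n0 = nat \<lceil>Q ^ N\<rceil>"
  have K: "1 \<le> K" "256 * real t ^ 3 * c < 3 * real K"
    using real_nat_ceiling_ge[of "256 * real t ^ 3 * c"] by (simp_all add: K_def)
  have N: "N > 0" using t by (simp add: N_def)
  have nn: "0 \<le> real K" "0 \<le> 4 * real (Suc J) * real D" "0 \<le> 4 * real (Suc J) * (real t * real (t * K) ^ t)"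
    "0 \<le> 8 * real t ^ 2 * real (Suc J)" by simp_all
  have "card {a\<in>A. D \<le> card (F a)} \<le> (card B)\<^sup>2"
    if fin: "finite A" "finite B" and FB: "\<forall>a\<in>A. F a \<subseteq> B"
      and cov: "\<forall>S\<subseteq>A. real (card {v\<in>B. t \<le> card {a\<in>S. v \<in> F a}}) \<le> c * real (card S)"
      and free: "\<forall>T\<subseteq>B. card T = t \<longrightarrow> card {a\<in>A. T \<subseteq> F a} \<le> t" and n0: "n0 \<le> card B"
    for A :: "'a set" and B :: "'b set" and F
  proof (rule ccontr)
    assume "\<not> ?thesis"
    then have "(card B)\<^sup>2 \<le> card {a\<in>A. D \<le> card (F a)}" by simp
    then obtain A' where A': "A' \<subseteq> {a\<in>A. D \<le> card (F a)}" "card A' = (card B)\<^sup>2"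
      by (rule obtain_subset_with_card_n)
    then have A'A: "A' \<subseteq> A" by auto
    then have finA': "finite A'" using fin(1) by (rule finite_subset)
    have "\<forall>a\<in>A'. \<exists>P. P \<subseteq> F a \<and> card P = D"
    proof
      fix a assume "a \<in> A'"
      then have "D \<le> card (F a)" using A' by blast
      then show "\<exists>P. P \<subseteq> F a \<and> card P = D" using obtain_subset_with_card_n by metis
    qed
    then obtain G where G: "\<And>a. a \<in> A' \<Longrightarrow> G a \<subseteq> F a" "\<And>a. a \<in> A' \<Longrightarrow> card (G a) = D" by metis
    define q where "q = root N (real (card B))"
    have qn: "q ^ N = real (card B)" using N by (simp add: q_def)
    have "Q ^ N \<le> q ^ N" using n0 unfolding qn n0_def by linarith
    then have Qq: "Q \<le> q" using N by (intro power_le_imp_le_base[of Q "N - 1" q]) (auto simp: q_def)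
    show False
    proof (rule no_dense_uniform_hypergraph[where F = G, OF t K N_def J_def D_def finA' fin(2) refl A'(2) _ _ _ qn])
      show "G a \<subseteq> B \<and> card (G a) = D" if "a \<in> A'" for a using that G A'A FB by blast
      show "real (card {v\<in>B. t \<le> card {a\<in>S. v \<in> G a}}) \<le> c * real (card S)" if S: "S \<subseteq> A'" for S
      proof -
        have "card {a\<in>S. v \<in> G a} \<le> card {a\<in>S. v \<in> F a}" for v
          using S G(1) finite_subset[OF S finA'] by (intro card_mono) auto
        then have "card {v\<in>B. t \<le> card {a\<in>S. v \<in> G a}} \<le> card {v\<in>B. t \<le> card {a\<in>S. v \<in> F a}}"
          using fin by (intro card_mono) (auto intro: order_trans)
        then have "real (card {v\<in>B. t \<le> card {a\<in>S. v \<in> G a}}) \<le> real (card {v\<in>B. t \<le> card {a\<in>S. v \<in> F a}})"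
          by (rule of_nat_mono)
        also have "\<dots> \<le> c * real (card S)" using cov S A'A by simp
        finally show ?thesis .
      qed
      show "card {a\<in>A'. T \<subseteq> G a} \<le> t" if "T \<subseteq> B" "card T = t" for T
      proof -
        have "card {a\<in>A'. T \<subseteq> G a} \<le> card {a\<in>A. T \<subseteq> F a}"
          using A'A G(1) fin by (intro card_mono) fastforce+
        also have "\<dots> \<le> t" using free that by blast
        finally show ?thesis .
      qed
      show "1 < q" using nn Qq unfolding Q_def by linarith
      show "real K \<le> q" using nn Qq unfolding Q_def by linarith
      show "4 * real (Suc J) * real D \<le> q" using nn Qq unfolding Q_def by linarith
      show "4 * real (Suc J) * (real t * real (t * K) ^ t) \<le> q" using nn Qq unfolding Q_def by linarith
      show "8 * real t ^ 2 * real (Suc J) \<le> q" using nn Qq unfolding Q_def by linarith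
    qed
  qed
  then show ?thesis by blast
qed

lemma card_edges_primal_bound:
  fixes t d :: nat and C :: real
  assumes t: "1 \<le> t" and d: "1 \<le> d"
  shows "\<exists>K\<ge>0. \<forall>(A :: 'a set) (B :: 'b set) E. bipartite_graph A B E \<longrightarrow>
    (\<forall>l\<ge>1. real (primal_shatter A B E l) \<le> C * real l ^ d) \<longrightarrow> biclique_free t A B E \<longrightarrow>
    real (card E) \<le> K * (real (card A) * real (card B) powr (1 - 1 / real d)
      + real (card B) powr (1 + 1 / real d) * ln (real (card B)))"
proof -
  \<comment> \<open>The constant \<open>C\<close> may have any sign, whereas the degree estimates
    need a positive \<open>c\<close>.\<close>
  define c where "c = real t * \<bar>C\<bar> + 1"
  have c: "c > 0" by (simp add: c_def add_nonneg_pos)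
  obtain D n0 where Dn0: "\<forall>(A :: 'a set) (B :: 'b set) F. finite A \<longrightarrow> finite B \<longrightarrow> (\<forall>a\<in>A. F a \<subseteq> B) \<longrightarrow>
    (\<forall>S\<subseteq>A. real (card {v\<in>B. t \<le> card {a\<in>S. v \<in> F a}}) \<le> c * real (card S)) \<longrightarrow>
    (\<forall>T\<subseteq>B. card T = t \<longrightarrow> card {a\<in>A. T \<subseteq> F a} \<le> t) \<longrightarrow> n0 \<le> card B \<longrightarrow>
    card {a\<in>A. D \<le> card (F a)} \<le> (card B)\<^sup>2"
    using card_large_hyperedges_le[OF t, of c] by (elim exE) (rule that)
  define M where "M = (2 * real t * ln (2 * real t) + 1) * (4 * c) powr (1 / real d)"
  have "ln (2 * real t) \<ge> 0" using t by simp
  then have M: "M \<ge> 0" by (simp add: M_def)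
  \<comment> \<open>This dominates the coefficients arising in all cases. The divisions by
    \<open>ln 2\<close> come from absorbing \<open>n\<close>, and for \<open>d = 1\<close> also
    \<open>n\<^sup>2\<close>, into the term with \<open>ln n\<close>.\<close>
  define K where "K = 3 * M + real t / ln 2 + M / ln 2 + real D + real n0 + 1"
  have ln2: "ln 2 > (0::real)" by simp
  have nn: "real t / ln 2 \<ge> 0" "M / ln 2 \<ge> 0" "real D \<ge> 0" "real n0 \<ge> 0" using M by auto
  have K: "K \<ge> 0" unfolding K_def using nn M by linarith
  have "real (card E) \<le> K * (real (card A) * real (card B) powr (1 - 1 / real d)
      + real (card B) powr (1 + 1 / real d) * ln (real (card B)))"
    if G: "bipartite_graph A B E" and sh: "\<forall>l\<ge>1. real (primal_shatter A B E l) \<le> C * real l ^ d"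
      and free: "biclique_free t A B E" for A :: "'a set" and B :: "'b set" and E
  proof -
    define m where "m = real (card A)"
    define n where "n = real (card B)"
    have fin: "finite A" "finite B" and EAB: "E \<subseteq> A \<times> B" using G by (auto simp: bipartite_graph_def)
    define N where "N = (\<lambda>b. E\<inverse> `` {b})"
    have NA: "N b \<subseteq> A" for b using EAB by (auto simp: N_def)
    have cov: "real (card {b\<in>B. t \<le> card (S \<inter> N b)}) \<le> c * real (card S) ^ d" if "S \<subseteq> A" "S \<noteq> {}" for S
    proof -
      have "real (card {b\<in>B. t \<le> card (S \<inter> N b)}) \<le> real t * C * real (card S) ^ d"
        unfolding N_def using card_trace_ge_le[OF G free _ that] sh by blast
      also have "\<dots> \<le> c * real (card S) ^ d"
      proof (rule mult_right_mono)
        have "real t * C \<le> real t * \<bar>C\<bar>" by (intro mult_left_mono) auto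
        then show "real t * C \<le> c" by (simp add: c_def)
      qed simp
      finally show ?thesis .
    qed
    have cE: "card E = (\<Sum>b\<in>B. card (N b))"
    proof -
      have "card E = card (E\<inverse>)" by (simp add: card_inverse)
      also have "E\<inverse> = Sigma B N" using EAB by (auto simp: N_def)
      also have "card (Sigma B N) = (\<Sum>b\<in>B. card (N b))"
        using fin NA finite_subset by (intro card_SigmaI) blast+
      finally show ?thesis .
    qed
    have Emn: "real (card E) \<le> m * n"
    proof -
      have "card E \<le> card A * card B" using EAB fin by (metis card_cartesian_product card_mono finite_cartesian_product)
      then show ?thesis unfolding m_def n_def by (metis of_nat_le_iff of_nat_mult)
    qed
    define X where "X = m * n powr (1 - 1 / real d)"
    define Y where "Y = n powr (1 + 1 / real d) * ln n"
    have m0: "m \<ge> 0" by (simp add: m_def)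
    have X: "X \<ge> 0" using m0 by (simp add: X_def)
    \<comment> \<open>The logarithmic term vanishes for \<open>n = 1\<close>, where only the summand
      1 of \<open>K\<close> is needed. From \<open>n = 2\<close> on, \<open>ln n\<close> is at least
      \<open>ln 2\<close>.\<close>
    consider "n = 0" | "n = 1" | "n \<ge> 2" unfolding n_def by (cases "card B \<le> 1") (auto simp: le_Suc_eq)
    then have "real (card E) \<le> K * (X + Y)"
    proof cases
      case 1
      then show ?thesis using Emn by (simp add: X_def Y_def)
    next
      case 2
      have "1 * m \<le> K * m" using nn M m0 unfolding K_def by (intro mult_right_mono) linarith+
      with 2 Emn show ?thesis by (simp add: X_def Y_def)
    next
      case n: 3
      have lnn: "ln 2 \<le> ln n" using n by simp
      have Y: "Y \<ge> 0" using n by (simp add: Y_def)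
      have nY: "n * ln 2 \<le> Y"
      proof -
        have "n powr 1 \<le> n powr (1 + 1 / real d)" using n by (intro powr_mono) auto
        then show ?thesis unfolding Y_def using n lnn ln2 by (intro mult_mono) auto
      qed
      then have "real t * (n * ln 2) \<le> real t * Y" by (rule mult_left_mono) simp
      then have tn: "real t * n \<le> real t / ln 2 * Y" using ln2 by (simp add: field_simps)
      have "\<exists>k1 k2. k1 \<le> K \<and> k2 \<le> K \<and> real (card E) \<le> k1 * X + k2 * Y"
      proof (cases "2 \<le> d")
        case True
        have "real (card E) \<le> M * (m * (\<Sum>i=1..card B. real i powr (- 1 / real d))) + real t * n"
          unfolding cE of_nat_sum M_def m_def n_def using sum_degrees_le[where N = N, OF fin NA c d t cov] .
        also have "\<dots> \<le> M * (m * (2 * n powr (1 - 1 / real d))) + real t * n"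
          using sum_powr_le[OF True, of "card B"] M m0 unfolding n_def
          by (intro add_right_mono mult_left_mono) auto
        also have "\<dots> \<le> 2 * M * X + real t / ln 2 * Y" using tn by (simp add: X_def mult_ac)
        finally show ?thesis
          by (rule exI[of _ "2 * M", OF exI[of _ "real t / ln 2"], OF conjI[OF _ conjI], rotated 2])
            (use nn M in \<open>auto simp: K_def\<close>)
      next
        case False
        then have d1: "d = 1" using d by simp
        have Xm: "X = m" using n by (simp add: X_def d1)
        have Yn: "Y = n\<^sup>2 * ln n" using n by (simp add: Y_def d1)
        show ?thesis
        proof (cases "n0 \<le> card B")
          case small: False
          have "real (card E) \<le> m * real n0" using Emn small m0 unfolding n_def
            by (smt (verit) mult_left_mono nat_le_linear of_nat_le_iff)
          then have "real (card E) \<le> real n0 * X + 0 * Y" by (simp add: Xm mult.commute)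
          moreover have "real n0 \<le> K" "0 \<le> K" using nn M unfolding K_def by linarith+
          ultimately show ?thesis by blast
        next
          case True
          \<comment> \<open>Edges at vertices of \<open>A\<close> outside \<open>A'\<close> number
            at most \<open>m * D\<close>. On \<open>A'\<close>, of size at most
            \<open>n\<^sup>2\<close>, the harmonic sum costs only
            \<open>n\<^sup>2 * (1 + ln n)\<close>, a multiple of \<open>Y\<close>.\<close>
          define A' where "A' = {a\<in>A. D \<le> card (E `` {a})}"
          have finA': "finite A'" using fin by (simp add: A'_def)
          have "card A' \<le> (card B)\<^sup>2"
            unfolding A'_def
          proof (rule Dn0[rule_format, OF fin _ _ _ True])
            show "E `` {a} \<subseteq> B" if "a \<in> A" for a using EAB by auto
            show "real (card {v\<in>B. t \<le> card {a\<in>S. v \<in> E `` {a}}}) \<le> c * real (card S)" if S: "S \<subseteq> A" for S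
            proof (cases "S = {}")
              case True
              then show ?thesis using t by simp
            next
              case False
              have "{a\<in>S. v \<in> E `` {a}} = S \<inter> N v" for v by (auto simp: N_def)
              then show ?thesis using cov[OF S False] by (simp add: d1)
            qed
            show "card {a\<in>A. T \<subseteq> E `` {a}} \<le> t" if T: "T \<subseteq> B" "card T = t" for T
            proof (rule ccontr)
              assume "\<not> ?thesis"
              then obtain S where S: "S \<subseteq> {a\<in>A. T \<subseteq> E `` {a}}" "card S = t"
                by (meson nat_le_linear obtain_subset_with_card_n)
              then have "S \<subseteq> A" "S \<times> T \<subseteq> E" by auto
              with S T free show False unfolding biclique_free_def by blast
            qed
          qed
          then have cA': "real (card A') \<le> n\<^sup>2" unfolding n_def by (metis of_nat_le_iff of_nat_power)
          have s: "(\<Sum>b\<in>B. real (card (A' \<inter> N b))) \<le>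
              M * (real (card A') * (\<Sum>i=1..card B. real i powr (- 1 / real d))) + real t * n"
            unfolding M_def n_def
          proof (rule sum_degrees_le[where N = "\<lambda>b. A' \<inter> N b", OF finA' fin(2) _ c d t])
            fix S assume S: "S \<subseteq> A'" "S \<noteq> {}"
            then have "S \<inter> (A' \<inter> N b) = S \<inter> N b" for b by auto
            moreover have "S \<subseteq> A" using S by (auto simp: A'_def)
            ultimately show "real (card {b\<in>B. t \<le> card (S \<inter> (A' \<inter> N b))}) \<le> c * real (card S) ^ d"
              using cov[of S] S by simp
          qed auto
          have "(\<Sum>i=1..card B. real i powr (- 1 / real d)) \<le> 1 + ln n"
            using sum_powr_minus_one_le[of "card B"] n unfolding n_def by (simp add: d1)
          then have "real (card A') * (\<Sum>i=1..card B. real i powr (- 1 / real d)) \<le> n\<^sup>2 * (1 + ln n)"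
            using cA' n by (intro mult_mono sum_nonneg) auto
          then have "M * (real (card A') * (\<Sum>i=1..card B. real i powr (- 1 / real d))) \<le> M * (n\<^sup>2 * (1 + ln n))"
            using M by (rule mult_left_mono)
          also have "\<dots> = M * n\<^sup>2 + M * Y" by (simp add: Yn algebra_simps)
          also have "M * n\<^sup>2 \<le> M / ln 2 * Y"
          proof -
            have "n\<^sup>2 * ln 2 \<le> Y" unfolding Yn using lnn by (intro mult_left_mono) auto
            then have "M * (n\<^sup>2 * ln 2) \<le> M * Y" using M by (rule mult_left_mono)
            then show ?thesis using ln2 by (simp add: field_simps)
          qed
          finally have big: "(\<Sum>b\<in>B. real (card (A' \<inter> N b))) \<le> (M / ln 2 + M + real t / ln 2) * Y"
            using s tn by (simp add: distrib_right)
          have small: "(\<Sum>b\<in>B. card (N b - A')) \<le> card A * D"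
          proof -
            have "(\<Sum>b\<in>B. card (N b - A')) = (\<Sum>b\<in>B. card {a\<in>A - A'. b \<in> E `` {a}})"
              using NA by (intro sum.cong refl arg_cong[where f = card]) (auto simp: N_def)
            also have "\<dots> = (\<Sum>a\<in>A - A'. card (E `` {a}))"
              using fin EAB by (intro sum_card_incidences) auto
            also have "\<dots> \<le> (\<Sum>a\<in>A - A'. D)" by (intro sum_mono) (auto simp: A'_def)
            also have "\<dots> \<le> card A * D" using fin by (simp add: card_mono)
            finally show ?thesis .
          qed
          have "card (N b) = card (A' \<inter> N b) + card (N b - A')" for b
            using card_Diff_subset_Int[of "N b" A'] fin finite_subset[OF NA]
            by (metis Int_commute card_Int_Diff)
          then have "real (card E) = (\<Sum>b\<in>B. real (card (A' \<inter> N b))) + real (\<Sum>b\<in>B. card (N b - A'))"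
            unfolding cE by (simp add: sum.distrib)
          also have "real (\<Sum>b\<in>B. card (N b - A')) \<le> m * real D"
            using small unfolding m_def by (metis of_nat_le_iff of_nat_mult)
          finally have "real (card E) \<le> real D * X + (M / ln 2 + M + real t / ln 2) * Y"
            using big by (simp add: Xm mult.commute)
          moreover have "real D \<le> K" "M / ln 2 + M + real t / ln 2 \<le> K" using nn M unfolding K_def by linarith+
          ultimately show ?thesis by blast
        qed
      qed
      then obtain k1 k2 where k: "k1 \<le> K" "k2 \<le> K" "real (card E) \<le> k1 * X + k2 * Y" by blast
      have "k1 * X \<le> K * X" "k2 * Y \<le> K * Y" using k X Y by (auto intro: mult_right_mono)
      with k(3) show ?thesis by (simp add: distrib_left)
    qed
    then show ?thesis by (simp add: X_def Y_def m_def n_def)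
  qed
  with K show ?thesis by blast
qed

theorem theorem3:
  fixes t d d' :: nat and C :: real
  assumes "t \<ge> 2" and "d \<ge> 1" and "d' \<ge> 1"
  shows "\<exists>K::real. \<forall>(A::'a set) (B::'b set) E (m::nat) (n::nat).
           bipartite_graph A B E \<longrightarrow> card A = m \<longrightarrow> card B = n \<longrightarrow>
           (\<forall>l\<ge>1. real (primal_shatter A B E l) \<le> C * real l ^ d) \<longrightarrow>
           (\<forall>l\<ge>1. real (dual_shatter A B E l) \<le> C * real l ^ d') \<longrightarrow>
           biclique_free t A B E \<longrightarrow>
           real (card E) \<le> K * min
             (real m * real n powr (1 - 1 / real d)
                + real n powr (1 + 1 / real d) * ln (real n))
             (real n * real m powr (1 - 1 / real d')
                + real m powr (1 + 1 / real d') * ln (real m))"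
proof -
  have t: "1 \<le> t" using assms by simp
  obtain K1 where K1: "K1 \<ge> 0" "\<And>(A :: 'a set) (B :: 'b set) E. bipartite_graph A B E \<Longrightarrow>
    (\<forall>l\<ge>1. real (primal_shatter A B E l) \<le> C * real l ^ d) \<Longrightarrow> biclique_free t A B E \<Longrightarrow>
    real (card E) \<le> K1 * (real (card A) * real (card B) powr (1 - 1 / real d)
      + real (card B) powr (1 + 1 / real d) * ln (real (card B)))"
    using card_edges_primal_bound[OF t assms(2)] by blast
  obtain K2 where K2: "K2 \<ge> 0" "\<And>(A :: 'b set) (B :: 'a set) E. bipartite_graph A B E \<Longrightarrow>
    (\<forall>l\<ge>1. real (primal_shatter A B E l) \<le> C * real l ^ d') \<Longrightarrow> biclique_free t A B E \<Longrightarrow>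
    real (card E) \<le> K2 * (real (card A) * real (card B) powr (1 - 1 / real d')
      + real (card B) powr (1 + 1 / real d') * ln (real (card B)))"
    using card_edges_primal_bound[OF t assms(3)] by blast
  \<comment> \<open>For \<open>b = 0\<close> both powers are 0; otherwise the logarithm is
    nonnegative.\<close>
  have nonneg: "0 \<le> real a * real b powr x + real b powr y * ln (real b)" for a b :: nat and x y :: real
    by (cases "b = 0") auto
  show ?thesis
  proof (intro exI[of _ "max K1 K2"] allI impI)
    fix A :: "'a set" and B :: "'b set" and E and m n :: nat
    assume G: "bipartite_graph A B E" and mn: "card A = m" "card B = n"
      and P: "\<forall>l\<ge>1. real (primal_shatter A B E l) \<le> C * real l ^ d"
      and P': "\<forall>l\<ge>1. real (dual_shatter A B E l) \<le> C * real l ^ d'"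
      and free: "biclique_free t A B E"
    let ?X = "real m * real n powr (1 - 1 / real d) + real n powr (1 + 1 / real d) * ln (real n)"
    let ?Y = "real n * real m powr (1 - 1 / real d') + real m powr (1 + 1 / real d') * ln (real m)"
    have "real (card E) \<le> K1 * ?X" using K1(2)[OF G P free] mn by simp
    also have "\<dots> \<le> max K1 K2 * ?X" using nonneg by (intro mult_right_mono) auto
    finally have 1: "real (card E) \<le> max K1 K2 * ?X" .
    \<comment> \<open>Reversing the edges exchanges the parts and turns the dual shatter function
      into the primal one.\<close>
    have "bipartite_graph B A (E\<inverse>)" using G by (auto simp: bipartite_graph_def)
    moreover have "\<forall>l\<ge>1. real (primal_shatter B A (E\<inverse>) l) \<le> C * real l ^ d'"
      using P' by (simp add: primal_shatter_def dual_shatter_def)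
    moreover have "biclique_free t B A (E\<inverse>)"
      unfolding biclique_free_def
    proof
      assume "\<exists>S T. S \<subseteq> B \<and> T \<subseteq> A \<and> card S = t \<and> card T = t \<and> S \<times> T \<subseteq> E\<inverse>"
      then obtain S T where "S \<subseteq> B" "T \<subseteq> A" "card S = t" "card T = t" "S \<times> T \<subseteq> E\<inverse>" by blast
      moreover from this have "T \<times> S \<subseteq> E" by auto
      ultimately show False using free unfolding biclique_free_def by blast
    qed
    ultimately have "real (card (E\<inverse>)) \<le> K2 * ?Y" using K2(2)[of B A "E\<inverse>"] mn by simp
    then have "real (card E) \<le> K2 * ?Y" by (simp add: card_inverse)
    also have "\<dots> \<le> max K1 K2 * ?Y" using nonneg by (intro mult_right_mono) auto
    finally have 2: "real (card E) \<le> max K1 K2 * ?Y" .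
    show "real (card E) \<le> max K1 K2 * min ?X ?Y" using 1 2 by (simp add: min_def)
  qed
qed

end
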